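(* Let $P=P(x)$ be a solution of the generalised Chazy equation with parameter $k=\tfrac23$, and let $Q,R,\eta,\xi,\chi,J,c_1,c_2,c_3$ and the vector field $X^3$ be the functions and vector field built from $P$ as specified in the context. Consider the maximally symmetric $(2,3,5)$-distribution spanned, in local coordinates $(x,y,z,p,q)$, by $$X^1=\partial_q,\qquad X^2=\partial_x+e^{\frac12\int P\,dx}p\,\partial_y+e^{\frac12\int P\,dx}q\,\partial_p+e^{\int P\,dx}q^2\,\partial_z,$$ which is annihilated by the 1-forms $dy-pF''dx$, $dp-qF''dx$, $dz-q^2(F'')^2dx$ with $F''(x)=e^{\frac12\int P\,dx}$. Define $$\begin{aligned} S^1&=-\eta^2\Big(\tfrac29\big(216\xi^3+108P\xi^2+18(P^2+\tfrac Q{20})\xi+P^3+\tfrac{3PQ}{20}+\tfrac R5\big)e^{-\int P\,dx}y\\ &\qquad-2\big(24\xi^2+6P\xi+\tfrac13(P^2-\tfrac Q{10})\big)e^{-\frac12\int P\,dx}p+24\xi q\Big)X^1-8\eta^2X^2,\\ S^2&=\frac{e^{-\frac12\int P\,dx}}{4\eta}X^1,\\ S^3&=\ell_3X^1+\Big(\big(\tfrac16((6\xi+P)^2+\tfrac Q{20})e^{-\frac12\int P\,dx}y-\tfrac12(8\xi+P)p+e^{\frac12\int P\,dx}q\big)\eta^3\chi^2\\ &\qquad+\big(\tfrac12(6\xi+P)e^{-\frac12\int P\,dx}y-p\big)\eta\chi-\tfrac3\eta e^{-\frac12\int P\,dx}y\Big)X^2-c_3^2X^3, \end{aligned}$$ where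 $$\begin{aligned} \ell_3&=\eta e^{-\frac12\int P\,dx}\Big(\big(6\xi^2+\tfrac32P\xi+\tfrac1{12}(P^2-\tfrac Q{10})\big)\eta^2\chi-4\xi-\tfrac12P\Big)c_3^2+\frac{e^{-\frac12\int P\,dx}}{4\eta}c_2\\ &\quad+\eta^2\Big(\tfrac29\big(216\xi^3+108P\xi^2+18(P^2+\tfrac Q{20})\xi+P^3+\tfrac{3PQ}{20}+\tfrac R5\big)e^{-\int P\,dx}y\\ &\qquad-2\big(24\xi^2+6P\xi+\tfrac13(P^2-\tfrac Q{10})\big)e^{-\frac12\int P\,dx}p+24\xi q\Big)c_1. \end{aligned}$$ Then $\{S^1,S^2,S^3\}$ pairwise bracket-generates the Lie algebra of split $\mathfrak g_2$.
   Context: A $(2,3,5)$-distribution is a rank 2 distribution $D$ on a 5-manifold such that $[D,D]$ has rank 3 and $[D,[D,D]]$ is the full tangent bundle. It is maximally symmetric if its associated Nurowski conformal structure of signature $(2,3)$ has vanishing Weyl tensor; its local symmetry algebra is then split $\mathfrak g_2$. Everything is local, on domains where the functions used are defined and denominators do not vanish; all antiderivatives are fixed once and for all (the same choice of $\int P\,dx$ is used throughout). The generalised Chazy equation with parameter $k$ is $$P'''-2PP''+3P'^2-\frac{4}{36-k^2}(6P'-P^2)^2=0,\qquad {}'=\frac{d}{dx}.$$ With $Q=P^2-6P'$ and $R=PQ-\tfrac32Q'$, for $k=\tfrac23$ it is equivalent to the system $P'=\frac16(P^2-Q)$, $Q'=\frac23(PQ-R)$, $R'=PR+\frac1{80}Q^2$.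 Let $\eta=\eta(x)$ be a not identically zero solution of $\eta''-\frac1{40}Q\eta=0$, and set $\xi=\eta'/\eta$, $\chi=\int\eta^{-2}dx$, $$J=\frac\eta6e^{-\frac12\int P\,dx}\Big((6\xi+P)^2+\tfrac Q{20}\Big)y-\frac\eta2(8\xi+P)p+\eta e^{\frac12\int P\,dx}q,$$ $$c_1=\frac18J\chi^2-\frac18\Big(\frac1\eta p-\frac1{2\eta}(6\xi+P)e^{-\frac12\int P\,dx}y\Big)\chi-\frac3{8\eta^3}e^{-\frac12\int P\,dx}y,$$ $$\begin{aligned}c_2&=6z+6\chi J^2-16\Big(\frac1\eta p-\frac1{2\eta}(6\xi+P)e^{-\frac12\int P\,dx}y\Big)J-4(6\xi+P)p^2+2(6\xi+P)^2e^{-\frac12\int P\,dx}yp\\&\quad-\tfrac13(6\xi+P)^3e^{-\int P\,dx}y^2+Pp^2+\tfrac Q{10}e^{-\frac12\int P\,dx}yp+\tfrac R{30}e^{-\int P\,dx}y^2,\end{aligned}$$ $$c_3=-\frac12J\chi+\frac1\eta p-\frac1{2\eta}(6\xi+P)e^{-\frac12\int P\,dx}y,$$ $$\begin{aligned}X^3&=-\eta^3\chi e^{\frac12\int P\,dx}\partial_y-\frac{\eta^3\chi}2(6\xi+P)\partial_p+\eta\,\partial_p\\ &\quad+\eta^3\chi\Big(e^{-\frac12\int P\,dx}\big(12\xi^3+6P\xi^2+(P^2+\tfrac Q{20})\xi+\tfrac1{18}P^3+\tfrac{PQ}{120}+\tfrac R{90}\big)y-\big(12\xi^2+3P\xi+\tfrac16P^2-\tfrac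 Q{60}\big)p\Big)\partial_z\\ &\quad+\eta\Big(\tfrac13\big((6\xi+P)^2+\tfrac Q{20}\big)e^{-\frac12\int P\,dx}y-(8\xi+P)p+4e^{\frac12\int P\,dx}q\Big)\partial_z.\end{aligned}$$ Definition (pairwise bracket-generating split $\mathfrak g_2$). Given vector fields $S^1,S^2,S^3$, put $S^4=[S^1,S^2]$, $S^5=[S^2,S^3]$, $S^6=[S^3,S^1]$, $L^1=[S^1,S^4]$, $L^2=[S^2,S^4]$, $L^3=[S^2,S^5]$, $L^4=[S^3,S^5]$, $L^5=[S^3,S^6]$, $L^6=[S^1,S^6]$, $H=[S^2,S^6]$, $h=[S^4,S^3]$. One says $\{S^1,S^2,S^3\}$ pairwise bracket-generates the Lie algebra of split $\mathfrak g_2$ if the 14 vector fields $S^1,\dots,S^6$, $h^1=\frac14(h-H)$, $h^2=\frac{\sqrt3}{12}(h+H)$, $L^1,\dots,L^6$ form a basis of a 14-dimensional Lie algebra isomorphic to split $\mathfrak g_2$, with Cartan subalgebra spanned by $h^1,h^2$ and root vectors with the following roots (simultaneous eigenvalues of $(\mathrm{ad}\,h^1,\mathrm{ad}\,h^2)$): $S^1:(1,0)$, $S^5:(-1,0)$, $S^4:(\frac12,\frac{\sqrt3}2)$, $S^3:(-\frac12,-\frac{\sqrt3}2)$, $S^2:(-\frac12,\frac{\sqrt3}2)$, $S^6:(\frac12,-\frac{\sqrt3}2)$, $L^2:(0,\sqrt3)$, $L^5:(0,-\sqrt3)$, $L^1:(\frac32,\frac{\sqrt3}2)$, $L^4:(-\frac32,-\frac{\sqrt3}2)$,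 $L^3:(-\frac32,\frac{\sqrt3}2)$, $L^6:(\frac32,-\frac{\sqrt3}2)$. (For complex-valued data the algebra is taken over $\mathbb C$.) *)

theory Defs
  imports "HOL-Analysis.Analysis" "HOL-Library.Function_Algebras"
begin

section \<open>Lie algebras\<close>

locale lie_algebra = vector_space scale
  for scale :: "'a::field \<Rightarrow> 'v::ab_group_add \<Rightarrow> 'v" +
  fixes L :: "'v set" and bracket :: "'v \<Rightarrow> 'v \<Rightarrow> 'v"
  assumes subspace_L: "subspace L"
    and bracket_closed: "x \<in> L \<Longrightarrow> y \<in> L \<Longrightarrow> bracket x y \<in> L"
    and bracket_add_left:
      "x \<in> L \<Longrightarrow> y \<in> L \<Longrightarrow> z \<in> L \<Longrightarrow> bracket (x + y) z = bracket x z + bracket y z"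
    and bracket_add_right:
      "x \<in> L \<Longrightarrow> y \<in> L \<Longrightarrow> z \<in> L \<Longrightarrow> bracket x (y + z) = bracket x y + bracket x z"
    and bracket_scale_left:
      "x \<in> L \<Longrightarrow> y \<in> L \<Longrightarrow> bracket (scale c x) y = scale c (bracket x y)"
    and bracket_scale_right:
      "x \<in> L \<Longrightarrow> y \<in> L \<Longrightarrow> bracket x (scale c y) = scale c (bracket x y)"
    and bracket_self: "x \<in> L \<Longrightarrow> bracket x x = 0"
    and jacobi: "x \<in> L \<Longrightarrow> y \<in> L \<Longrightarrow> z \<in> L \<Longrightarrow>
      bracket x (bracket y z) + bracket y (bracket z x) + bracket z (bracket x y) = 0"

definition lie_isomorphic ::
  "('a::field \<Rightarrow> 'v::ab_group_add \<Rightarrow> 'v) \<Rightarrow> 'v set \<Rightarrow> ('v \<Rightarrow> 'v \<Rightarrow> 'v) \<Rightarrow>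
   ('a \<Rightarrow> 'w::ab_group_add \<Rightarrow> 'w) \<Rightarrow> 'w set \<Rightarrow> ('w \<Rightarrow> 'w \<Rightarrow> 'w) \<Rightarrow> bool"
  where
  "lie_isomorphic scale1 L1 bracket1 scale2 L2 bracket2 \<longleftrightarrow>
     (\<exists>\<phi>. bij_betw \<phi> L1 L2 \<and>
        (\<forall>x\<in>L1. \<forall>y\<in>L1. \<phi> (x + y) = \<phi> x + \<phi> y) \<and>
        (\<forall>c. \<forall>x\<in>L1. \<phi> (scale1 c x) = scale2 c (\<phi> x)) \<and>
        (\<forall>x\<in>L1. \<forall>y\<in>L1. \<phi> (bracket1 x y) = bracket2 (\<phi> x) (\<phi> y)))"

primrec lower_central_series ::
  "('a::field \<Rightarrow> 'v::ab_group_add \<Rightarrow> 'v) \<Rightarrow> 'v set \<Rightarrow> ('v \<Rightarrow> 'v \<Rightarrow> 'v) \<Rightarrow> nat \<Rightarrow> 'v set"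
  where
  "lower_central_series sc L bracket 0 = L"
| "lower_central_series sc L bracket (Suc n) =
     module.span sc
       {bracket x y | x y. x \<in> L \<and> y \<in> lower_central_series sc L bracket n}"

text \<open>A Cartan subalgebra is a nilpotent subalgebra that equals its own normalizer.\<close>

definition cartan_subalgebra ::
  "('a::field \<Rightarrow> 'v::ab_group_add \<Rightarrow> 'v) \<Rightarrow> 'v set \<Rightarrow> ('v \<Rightarrow> 'v \<Rightarrow> 'v) \<Rightarrow> 'v set \<Rightarrow> bool"
  where
  "cartan_subalgebra sc L bracket C \<longleftrightarrow>
     C \<subseteq> L \<and> lie_algebra sc C bracket \<and>
     (\<exists>n. lower_central_series sc C bracket n = {0}) \<and>
     {x \<in> L. \<forall>c\<in>C. bracket x c \<in> C} = C"

definition root_vector ::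
  "('a::field \<Rightarrow> 'v::ab_group_add \<Rightarrow> 'v) \<Rightarrow> ('v \<Rightarrow> 'v \<Rightarrow> 'v) \<Rightarrow> 'v \<Rightarrow> 'v \<Rightarrow> 'v \<Rightarrow> 'a \<times> 'a \<Rightarrow> bool"
  where
  "root_vector sc bracket h1 h2 X \<rho> \<longleftrightarrow>
     X \<noteq> 0 \<and> bracket h1 X = sc (fst \<rho>) X \<and> bracket h2 X = sc (snd \<rho>) X"


section \<open>The split Lie algebra of type G2\<close>

text \<open>The split octonions over \<open>'a\<close> are Zorn's vector matrices: the tuple \<open>(a, u, v, b)\<close> stands
  for the matrix with rows \<open>(a, u)\<close> and \<open>(v, b)\<close>, and the norm \<open>a * b - u \<cdot> v\<close> is multiplicative.
  The split Lie algebra of type G2 is the Lie algebra of their derivations.\<close>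

type_synonym 'a zorn = "'a \<times> ('a^3) \<times> ('a^3) \<times> 'a"

definition zorn_dot :: "'a::comm_ring_1^3 \<Rightarrow> 'a^3 \<Rightarrow> 'a" where
  "zorn_dot u v = (\<Sum>i\<in>UNIV. u $ i * v $ i)"

definition zorn_cross :: "'a::comm_ring_1^3 \<Rightarrow> 'a^3 \<Rightarrow> 'a^3" where
  "zorn_cross u v =
     vector [u$2 * v$3 - u$3 * v$2, u$3 * v$1 - u$1 * v$3, u$1 * v$2 - u$2 * v$1]"

fun zorn_mult :: "'a::comm_ring_1 zorn \<Rightarrow> 'a zorn \<Rightarrow> 'a zorn" where
  "zorn_mult (a, u, v, b) (a', u', v', b') =
     (a * a' + zorn_dot u v',
      a *s u' + b' *s u + zorn_cross v v',
      a' *s v + b *s v' - zorn_cross u u',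
      b * b' + zorn_dot v u')"

fun zorn_scale :: "'a::comm_ring_1 \<Rightarrow> 'a zorn \<Rightarrow> 'a zorn" where
  "zorn_scale c (a, u, v, b) = (c * a, c *s u, c *s v, c * b)"

definition zorn_op_scale :: "'a::comm_ring_1 \<Rightarrow> ('a zorn \<Rightarrow> 'a zorn) \<Rightarrow> 'a zorn \<Rightarrow> 'a zorn" where
  "zorn_op_scale c D = (\<lambda>w. zorn_scale c (D w))"

definition commutator :: "('v \<Rightarrow> 'v) \<Rightarrow> ('v \<Rightarrow> 'v) \<Rightarrow> 'v \<Rightarrow> 'v::ab_group_add" where
  "commutator D D' = (\<lambda>w. D (D' w) - D' (D w))"

definition split_g2 :: "('a::field zorn \<Rightarrow> 'a zorn) set" where
  "split_g2 = {D. Vector_Spaces.linear zorn_scale zorn_scale D \<and>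
     (\<forall>w w'. D (zorn_mult w w') = zorn_mult (D w) w' + zorn_mult w (D w'))}"


section \<open>Vector fields on open subsets of 5-space\<close>

text \<open>Points of \<open>real^5\<close> carry the coordinates \<open>(x, y, z, p, q) = (u$1, u$2, u$3, u$4, u$5)\<close>.
  A vector field on an open set \<open>U\<close>, with coefficients in \<open>'a\<close>, is represented by its tuple of
  coefficients with respect to the coordinate fields \<open>axis i 1\<close>, extended by \<open>0\<close> outside \<open>U\<close>, so
  that equality of functions is equality of fields on \<open>U\<close>. The type \<open>'a\<close> ranges over the reals and
  the complex numbers; in the latter case the fields are sections of the complexified tangent
  bundle, and the vector space structure is the one over the complex numbers.\<close>

text \<open>\<open>smooth_on U f\<close> means that \<open>f\<close> is infinitely differentiable on the open set \<open>U\<close>: \<open>f\<close> and all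
  its iterated partial derivatives are differentiable at every point of \<open>U\<close>. In particular the
  derivatives in the bracket of two fields that are smooth on \<open>U\<close> are genuine.\<close>

coinductive smooth_on :: "'e::euclidean_space set \<Rightarrow> ('e \<Rightarrow> 'v::real_normed_vector) \<Rightarrow> bool"
  for U where
  "\<lbrakk>\<forall>u\<in>U. f differentiable (at u);
    \<forall>b\<in>Basis. smooth_on U (\<lambda>u. frechet_derivative f (at u) b)\<rbrakk> \<Longrightarrow> smooth_on U f"

definition restrict_field :: "(real^5) set \<Rightarrow> (real^5 \<Rightarrow> 'a::real_normed_field^5) \<Rightarrow> real^5 \<Rightarrow> 'a^5"
  where "restrict_field U X = (\<lambda>u. if u \<in> U then X u else 0)"

definition vector_fields :: "(real^5) set \<Rightarrow> (real^5 \<Rightarrow> 'a::real_normed_field^5) set" where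
  "vector_fields U = {X. smooth_on U X \<and> (\<forall>u. u \<notin> U \<longrightarrow> X u = 0)}"

definition field_scale :: "'a::real_normed_field \<Rightarrow> (real^5 \<Rightarrow> 'a^5) \<Rightarrow> real^5 \<Rightarrow> 'a^5" where
  "field_scale c X = (\<lambda>u. c *s X u)"

definition partial_deriv :: "5 \<Rightarrow> (real^5 \<Rightarrow> 'v::real_normed_vector) \<Rightarrow> real^5 \<Rightarrow> 'v" where
  "partial_deriv i F u = frechet_derivative F (at u) (axis i 1)"

definition field_bracket ::
  "(real^5) set \<Rightarrow> (real^5 \<Rightarrow> 'a::real_normed_field^5) \<Rightarrow> (real^5 \<Rightarrow> 'a^5) \<Rightarrow> real^5 \<Rightarrow> 'a^5"
  where
  "field_bracket U X Y = restrict_field U (\<lambda>u.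
     \<Sum>i\<in>UNIV. X u $ i *s partial_deriv i Y u - Y u $ i *s partial_deriv i X u)"

lemma vector_space_field_scale:
  "vector_space (field_scale :: 'a::real_normed_field \<Rightarrow> _)"
  by unfold_locales
    (auto simp: field_scale_def fun_eq_iff vec_eq_iff algebra_simps)

lemma vector_space_zorn_scale: "vector_space (zorn_scale :: 'a::field \<Rightarrow> _)"
  by unfold_locales (auto simp: vec_eq_iff algebra_simps)

lemma vector_space_zorn_op_scale: "vector_space (zorn_op_scale :: 'a::field \<Rightarrow> _)"
proof -
  interpret vector_space "zorn_scale :: 'a \<Rightarrow> _" by (rule vector_space_zorn_scale)
  show ?thesis
    by unfold_locales (auto simp: zorn_op_scale_def fun_eq_iff algebra_simps)
qed

definition pairwise_bracket_generates_split_g2 ::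
  "(real^5) set \<Rightarrow> (real^5 \<Rightarrow> 'a::real_normed_field^5) \<Rightarrow> (real^5 \<Rightarrow> 'a^5) \<Rightarrow> (real^5 \<Rightarrow> 'a^5) \<Rightarrow> bool"
  where
  "pairwise_bracket_generates_split_g2 U S1 S2 S3 \<longleftrightarrow>
     (let br = field_bracket U;
          S4 = br S1 S2; S5 = br S2 S3; S6 = br S3 S1;
          L1 = br S1 S4; L2 = br S2 S4; L3 = br S2 S5;
          L4 = br S3 S5; L5 = br S3 S6; L6 = br S1 S6;
          H = br S2 S6; h = br S4 S3;
          h1 = field_scale (1/4) (h - H);
          h2 = field_scale (of_real (sqrt 3) / 12) (h + H);
          basis = [S1, S2, S3, S4, S5, S6, h1, h2, L1, L2, L3, L4, L5, L6];
          \<g> = module.span field_scale (set basis);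
          root = root_vector field_scale br h1 h2;
          r = of_real (sqrt 3)
      in {S1, S2, S3} \<subseteq> vector_fields U \<and>
         distinct basis \<and> \<not> module.dependent field_scale (set basis) \<and>
         lie_algebra field_scale \<g> br \<and>
         lie_isomorphic field_scale \<g> br zorn_op_scale (split_g2 :: ('a zorn \<Rightarrow> 'a zorn) set) commutator \<and>
         cartan_subalgebra field_scale \<g> br (module.span field_scale {h1, h2}) \<and>
         root S1 (1, 0) \<and> root S5 (-1, 0) \<and>
         root S4 (1/2, r/2) \<and> root S3 (-1/2, -r/2) \<and>
         root S2 (-1/2, r/2) \<and> root S6 (1/2, -r/2) \<and>
         root L2 (0, r) \<and> root L5 (0, -r) \<and>
         root L1 (3/2, r/2) \<and> root L4 (-3/2, -r/2) \<and>
         root L3 (-3/2, r/2) \<and> root L6 (3/2, -r/2))"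


section \<open>The generalised Chazy equation and the associated vector fields\<close>

definition generalised_chazy :: "'a \<Rightarrow> real set \<Rightarrow> (real \<Rightarrow> 'a::real_normed_field) \<Rightarrow> bool" where
  "generalised_chazy k I P \<longleftrightarrow>
     (\<exists>P1 P2 P3. \<forall>x\<in>I.
        (P has_vector_derivative P1 x) (at x) \<and>
        (P1 has_vector_derivative P2 x) (at x) \<and>
        (P2 has_vector_derivative P3 x) (at x) \<and>
        P3 x - 2 * P x * P2 x + 3 * (P1 x)^2
          - 4 / (36 - k^2) * (6 * P1 x - (P x)^2)^2 = 0)"

text \<open>In the locale below, \<open>IP\<close> is the chosen antiderivative of \<open>P\<close>, and \<open>chi\<close> the one of
  \<open>1 / \<eta>^2\<close>. The functions \<open>B\<close>, \<open>K\<close>, \<open>T\<close> merely name subexpressions that occur repeatedly in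
  the formulas for \<open>c1\<close>, \<open>c2\<close>, \<open>c3\<close> (\<open>B\<close>), \<open>S1\<close>, \<open>l3\<close> (\<open>K\<close>), and \<open>J\<close>, \<open>X3\<close>, \<open>S3\<close> (\<open>T\<close>).
  The formulas are meaningful only where \<open>P\<close> and \<open>\<eta>\<close> are sufficiently differentiable and
  \<open>\<eta>\<close> does not vanish.\<close>

locale chazy_fields =
  fixes P IP \<eta> chi :: "real \<Rightarrow> 'a::{real_normed_field,banach}"
begin

definition Q :: "real \<Rightarrow> 'a" where
  "Q x = (P x)^2 - 6 * vector_derivative P (at x)"

definition R :: "real \<Rightarrow> 'a" where
  "R x = P x * Q x - 3/2 * vector_derivative Q (at x)"

definition eta_equation :: "real set \<Rightarrow> bool" where
  "eta_equation I \<longleftrightarrow>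
     (\<exists>\<eta>1 \<eta>2. \<forall>x\<in>I.
        (\<eta> has_vector_derivative \<eta>1 x) (at x) \<and>
        (\<eta>1 has_vector_derivative \<eta>2 x) (at x) \<and>
        \<eta>2 x - 1/40 * Q x * \<eta> x = 0)"

definition \<xi> :: "real \<Rightarrow> 'a" where
  "\<xi> x = vector_derivative \<eta> (at x) / \<eta> x"

definition T :: "real \<Rightarrow> 'a" where
  "T x = (6 * \<xi> x + P x)^2 + Q x / 20"

definition J :: "real^5 \<Rightarrow> 'a" where
  "J u = (let x = u$1; y = of_real (u$2); p = of_real (u$4); q = of_real (u$5) in
     \<eta> x / 6 * exp (- IP x / 2) * T x * y
     - \<eta> x / 2 * (8 * \<xi> x + P x) * p
     + \<eta> x * exp (IP x / 2) * q)"

definition B :: "real^5 \<Rightarrow> 'a" where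
  "B u = (let x = u$1; y = of_real (u$2); p = of_real (u$4) in
     1 / \<eta> x * p - 1 / (2 * \<eta> x) * (6 * \<xi> x + P x) * exp (- IP x / 2) * y)"

definition c1 :: "real^5 \<Rightarrow> 'a" where
  "c1 u = (let x = u$1; y = of_real (u$2) in
     1/8 * J u * (chi x)^2 - 1/8 * B u * chi x
     - 3 / (8 * (\<eta> x)^3) * exp (- IP x / 2) * y)"

definition c2 :: "real^5 \<Rightarrow> 'a" where
  "c2 u = (let x = u$1; y = of_real (u$2); z = of_real (u$3); p = of_real (u$4) in
     6 * z + 6 * chi x * (J u)^2 - 16 * B u * J u
     - 4 * (6 * \<xi> x + P x) * p^2
     + 2 * (6 * \<xi> x + P x)^2 * exp (- IP x / 2) * y * p
     - 1/3 * (6 * \<xi> x + P x)^3 * exp (- IP x) * y^2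
     + P x * p^2
     + Q x / 10 * exp (- IP x / 2) * y * p
     + R x / 30 * exp (- IP x) * y^2)"

definition c3 :: "real^5 \<Rightarrow> 'a" where
  "c3 u = - 1/2 * J u * chi (u$1) + B u"

definition X1 :: "real^5 \<Rightarrow> 'a^5" where
  "X1 u = axis 5 1"

definition X2 :: "real^5 \<Rightarrow> 'a^5" where
  "X2 u = (let x = u$1; p = of_real (u$4); q = of_real (u$5) in
     axis 1 1 + (exp (IP x / 2) * p) *s axis 2 1
     + (exp (IP x / 2) * q) *s axis 4 1
     + (exp (IP x) * q^2) *s axis 3 1)"

definition X3 :: "real^5 \<Rightarrow> 'a^5" where
  "X3 u = (let x = u$1; y = of_real (u$2); p = of_real (u$4); q = of_real (u$5) in
     - ((\<eta> x)^3 * chi x * exp (IP x / 2)) *s axis 2 1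
     - ((\<eta> x)^3 * chi x / 2 * (6 * \<xi> x + P x)) *s axis 4 1
     + \<eta> x *s axis 4 1
     + ((\<eta> x)^3 * chi x *
         (exp (- IP x / 2) *
            (12 * (\<xi> x)^3 + 6 * P x * (\<xi> x)^2 + ((P x)^2 + Q x / 20) * \<xi> x
             + 1/18 * (P x)^3 + P x * Q x / 120 + R x / 90) * y
          - (12 * (\<xi> x)^2 + 3 * P x * \<xi> x + 1/6 * (P x)^2 - Q x / 60) * p)) *s axis 3 1
     + (\<eta> x *
         (1/3 * T x * exp (- IP x / 2) * y - (8 * \<xi> x + P x) * p
          + 4 * exp (IP x / 2) * q)) *s axis 3 1)"

definition K :: "real^5 \<Rightarrow> 'a" where
  "K u = (let x = u$1; y = of_real (u$2); p = of_real (u$4); q = of_real (u$5) in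
     2/9 * (216 * (\<xi> x)^3 + 108 * P x * (\<xi> x)^2 + 18 * ((P x)^2 + Q x / 20) * \<xi> x
            + (P x)^3 + 3 * P x * Q x / 20 + R x / 5) * exp (- IP x) * y
     - 2 * (24 * (\<xi> x)^2 + 6 * P x * \<xi> x + 1/3 * ((P x)^2 - Q x / 10)) * exp (- IP x / 2) * p
     + 24 * \<xi> x * q)"

definition S1 :: "real^5 \<Rightarrow> 'a^5" where
  "S1 u = - ((\<eta> (u$1))^2 * K u) *s X1 u - (8 * (\<eta> (u$1))^2) *s X2 u"

definition S2 :: "real^5 \<Rightarrow> 'a^5" where
  "S2 u = (exp (- IP (u$1) / 2) / (4 * \<eta> (u$1))) *s X1 u"

definition l3 :: "real^5 \<Rightarrow> 'a" where
  "l3 u = (let x = u$1 in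
     \<eta> x * exp (- IP x / 2) *
       ((6 * (\<xi> x)^2 + 3/2 * P x * \<xi> x + 1/12 * ((P x)^2 - Q x / 10)) * (\<eta> x)^2 * chi x
        - 4 * \<xi> x - 1/2 * P x) * (c3 u)^2
     + exp (- IP x / 2) / (4 * \<eta> x) * c2 u
     + (\<eta> x)^2 * K u * c1 u)"

definition S3 :: "real^5 \<Rightarrow> 'a^5" where
  "S3 u = (let x = u$1; y = of_real (u$2); p = of_real (u$4); q = of_real (u$5) in
     l3 u *s X1 u
     + ((1/6 * T x * exp (- IP x / 2) * y - 1/2 * (8 * \<xi> x + P x) * p + exp (IP x / 2) * q)
          * (\<eta> x)^3 * (chi x)^2
        + (1/2 * (6 * \<xi> x + P x) * exp (- IP x / 2) * y - p) * \<eta> x * chi x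
        - 3 / \<eta> x * exp (- IP x / 2) * y) *s X2 u
     - (c3 u)^2 *s X3 u)"

end

end

theory Submission
  imports Defs
begin

text \<open>The five functions \<open>chi\<close>, \<open>J\<close>, \<open>c3\<close>, \<open>8 * c1 + 2 * c3 * chi\<close> and \<open>c2 / 4 + 2 * c3 * J\<close>
  are local coordinates in which \<open>S1\<close>, \<open>S2\<close> and \<open>S3\<close> become polynomial vector fields with constant
  coefficients: the solution \<open>P\<close> of the Chazy equation disappears. These coordinates are affine
  coordinates on the quadric of null lines in the imaginary split octonions, and the three fields
  are the infinitesimal actions of three short root vectors of the derivation algebra of the split
  octonions. This algebra is simple and generated by these root vectors, so its action lifts to an
  injective homomorphism into the vector fields on \<open>U\<close>, and all assertions on brackets, roots and
  the Cartan subalgebra follow from computations with derivations.\<close>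

section \<open>Derivations of the split octonions\<close>

text \<open>The coefficients of \<open>S3\<close> are too large for iterated brackets to be expanded
  directly. Only first derivatives of a few functions along \<open>S1\<close>, \<open>S2\<close>,
  \<open>S3\<close> are computed; every further bracket is a commutator of derivations. No inverse
  chart is constructed: it suffices that a field is determined by its action on the coordinate
  functions. Generation of the algebra gives a lift of each derivation, this determinacy makes the
  lift unique, and simplicity together with \<open>S2\<close> being nonzero gives injectivity. The
  coordinates originate in a Taylor chain: along \<open>S1\<close>, with \<open>W\<close> a rescaled
  \<open>y\<close>, one has dW/dchi = B, dB/dchi = J, dJ/dchi = 0, free of \<open>P\<close>. The
  three generators carry the coefficients -8, 1/8, -1; their product 1 is what fixes the eigenvalues
  of \<open>h1\<close> and \<open>h2\<close>.\<close>

text \<open>For traceless \<open>M\<close> this realises the Z/3-grading of G2 as sl3, its standard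
  module (\<open>r\<close>) and the dual module (\<open>s\<close>). Tracelessness is not built in;
  it appears as a hypothesis where it matters.\<close>

definition zder :: "'a::comm_ring_1^3^3 \<Rightarrow> 'a^3 \<Rightarrow> 'a^3 \<Rightarrow> 'a zorn \<Rightarrow> 'a zorn" where
  "zder M r s = (\<lambda>(a, u, v, b).
     (- zorn_dot s u - zorn_dot r v,
      (a - b) *s r + M *v u + zorn_cross v s,
      (a - b) *s s - transpose M *v v + zorn_cross u r,
      zorn_dot s u + zorn_dot r v))"

lemmas zorn_vec_simps =
  zorn_dot_def zorn_cross_def vec_eq_iff forall_3 sum_3 vector_3
  matrix_vector_mult_def transpose_def matrix_matrix_mult_def

lemmas zorn_component_simps = zder_def zorn_vec_simps

lemma zorn_dot_zero [simp]: "zorn_dot 0 v = 0" "zorn_dot u 0 = 0"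
  by (simp_all add: zorn_dot_def)

lemma zorn_cross_zero [simp]: "zorn_cross 0 v = 0" "zorn_cross u 0 = 0"
  by (simp_all add: zorn_component_simps)

lemma zorn_dot_commute: "zorn_dot u v = zorn_dot v u"
  by (simp add: zorn_dot_def mult.commute)

lemma zorn_cross_skew: "zorn_cross u v = - zorn_cross v u"
  by (simp add: zorn_component_simps algebra_simps)

text \<open>The decisive identity is M u x u' + u x M u' = (trace M) (u x u') - M^T (u x u'), so
  compatibility with the cross product amounts to tracelessness. The hypothesis is used by
  eliminating the last diagonal entry.\<close>

lemma zder_derivation:
  assumes "trace M = (0::'a::comm_ring_1)"
  shows "zder M r s (zorn_mult w w') = zorn_mult (zder M r s w) w' + zorn_mult w (zder M r s w')"
proof -
  have M: "M$3$3 = - M$1$1 - M$2$2"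
    using assms by (simp add: trace_def sum_3 algebra_simps add_eq_0_iff)
  show ?thesis
    by (cases w; cases w') (simp add: zorn_component_simps M algebra_simps)
qed

lemma linear_zder: "Vector_Spaces.linear zorn_scale zorn_scale (zder M r s :: 'a::field zorn \<Rightarrow> _)"
proof -
  interpret vector_space "zorn_scale :: 'a \<Rightarrow> _" by (rule vector_space_zorn_scale)
  show ?thesis
    by unfold_locales (auto simp: zorn_component_simps algebra_simps)
qed

lemma zder_in_split_g2: "trace M = 0 \<Longrightarrow> zder M r s \<in> split_g2"
  unfolding split_g2_def using linear_zder zder_derivation by blast

text \<open>The bracket respects the Z/3-grading: sl3 acts on both modules, the cross product sends
  two elements of one module to the other, and pairing the two modules returns to sl3. The scalar
  matrix cancels the trace of the rank one matrices.\<close>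

lemma commutator_zder:
  fixes M M' :: "'a::comm_ring_1^3^3"
  assumes "trace M = 0" "trace M' = 0"
  shows "commutator (zder M r s) (zder M' r' s') =
   zder (\<chi> i j. (M ** M') $ i $ j - (M' ** M) $ i $ j - 3 * r $ i * s' $ j + 3 * r' $ i * s $ j
           + (if i = j then zorn_dot r s' - zorn_dot r' s else 0))
     (M *v r' - M' *v r - 2 *s zorn_cross s s')
     (transpose M' *v s - transpose M *v s' - 2 *s zorn_cross r r')"
proof -
  have M: "M$3$3 = - M$1$1 - M$2$2" "M'$3$3 = - M'$1$1 - M'$2$2"
    using assms by (simp_all add: trace_def sum_3 algebra_simps add_eq_0_iff)
  show ?thesis
    by (rule ext) (auto simp: commutator_def zorn_component_simps M algebra_simps)
qed

lemma zder_eq_iff: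
  fixes M M' :: "'a::comm_ring_1^3^3"
  shows "zder M r s = zder M' r' s' \<longleftrightarrow> M = M' \<and> r = r' \<and> s = s'"
proof
  assume eq: "zder M r s = zder M' r' s'"
  have "r = r' \<and> s = s'"
    using fun_cong[OF eq, of "(1, 0, 0, 0)"] by (simp add: zorn_component_simps)
  moreover have "M *v u = M' *v u" for u
    using fun_cong[OF eq, of "(0, u, 0, 0)"] by (simp add: zder_def zorn_component_simps)
  hence "M = M'" by (metis matrix_eq)
  ultimately show "M = M' \<and> r = r' \<and> s = s'" by simp
qed simp

lemma split_g2_derivation:
  assumes "D \<in> split_g2"
  shows "D (w + w') = D w + D w'" "D (zorn_scale c w) = zorn_scale c (D w)"
    "D (zorn_mult w w') = zorn_mult (D w) w' + zorn_mult w (D w')"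
proof -
  interpret Vector_Spaces.linear zorn_scale zorn_scale D using assms by (simp add: split_g2_def)
  show "D (w + w') = D w + D w'" "D (zorn_scale c w) = zorn_scale c (D w)"
    by (simp_all add: add scale)
  show "D (zorn_mult w w') = zorn_mult (D w) w' + zorn_mult w (D w')"
    using assms unfolding split_g2_def by blast
qed

text \<open>A derivation is determined by the image \<open>(0, r, s, 0)\<close> of the idempotent \<open>e = (1, 0, 0, 0)\<close>
  and by its action on the Peirce components \<open>{(0, u, 0, 0)}\<close> and \<open>{(0, 0, v, 0)}\<close> of \<open>e\<close>.\<close>

lemma split_g2_eq:
  "(split_g2 :: ('a::field_char_0 zorn \<Rightarrow> 'a zorn) set) = {zder M r s | M r s. trace M = 0}"
proof (rule set_eqI, rule iffI)
  fix D :: "'a zorn \<Rightarrow> 'a zorn"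
  assume D: "D \<in> split_g2"
  note add = split_g2_derivation(1)[OF D] and scale = split_g2_derivation(2)[OF D]
    and mult = split_g2_derivation(3)[OF D]
  have D0: "D 0 = 0" using add[of 0 0] by simp
  have D0': "D (0, 0, 0, 0) = (0, 0, 0, 0)" using D0 by (simp add: zero_prod_def)
  obtain a r s b where "D (1, 0, 0, 0) = (a, r, s, b)" by (cases "D (1, 0, 0, 0)") auto
  hence De: "D (1, 0, 0, 0) = (0, r, s, 0)"
    using mult[of "(1, 0, 0, 0)" "(1, 0, 0, 0)"] by (auto simp: vec_eq_iff)
  have D1: "D (1, 0, 0, 1) = 0"
    using mult[of "(1, 0, 0, 1)" "(1, 0, 0, 1)"] by (cases "D (1, 0, 0, 1)") (auto simp: zero_prod_def)
  have Df: "D (0, 0, 0, 1) = (0, - r, - s, 0)"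
    using add[of "(1, 0, 0, 0)" "(0, 0, 0, 1)"] De D1
    by (cases "D (0, 0, 0, 1)") (auto simp: zero_prod_def eq_neg_iff_add_eq_0 add.commute)
  define \<mu> \<nu> where "\<mu> u = fst (snd (D (0, u, 0, 0)))" and "\<nu> v = fst (snd (snd (D (0, 0, v, 0))))" for u v
  have Du: "D (0, u, 0, 0) = (- zorn_dot s u, \<mu> u, zorn_cross u r, zorn_dot s u)" for u
  proof -
    obtain a m n b where *: "D (0, u, 0, 0) = (a, m, n, b)" by (cases "D (0, u, 0, 0)") auto
    show ?thesis
      using mult[of "(1, 0, 0, 0)" "(0, u, 0, 0)"] mult[of "(0, u, 0, 0)" "(1, 0, 0, 0)"]
      by (auto simp: \<mu>_def De * D0' zorn_cross_skew[of r] zorn_cross_skew[of s] zorn_dot_commute[of u] eq_neg_iff_add_eq_0 add.commute)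
  qed
  have Dv: "D (0, 0, v, 0) = (- zorn_dot r v, zorn_cross v s, \<nu> v, zorn_dot r v)" for v
  proof -
    obtain a m n b where *: "D (0, 0, v, 0) = (a, m, n, b)" by (cases "D (0, 0, v, 0)") auto
    show ?thesis
      using mult[of "(1, 0, 0, 0)" "(0, 0, v, 0)"] mult[of "(0, 0, v, 0)" "(1, 0, 0, 0)"]
      by (auto simp: \<nu>_def De * D0' zorn_cross_skew[of r] zorn_cross_skew[of s] zorn_dot_commute[of v] eq_neg_iff_add_eq_0 add.commute)
  qed
  define M where "M = (\<chi> i j. \<mu> (axis j 1) $ i)"
  have \<mu>_add: "\<mu> (u + u') = \<mu> u + \<mu> u'" and \<mu>_scale: "\<mu> (c *s u) = c *s \<mu> u" for u u' c
    using add[of "(0, u, 0, 0)" "(0, u', 0, 0)"] scale[of c "(0, u, 0, 0)"] by (simp_all add: Du)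
  have \<mu>: "\<mu> u = M *v u" for u
  proof -
    have "\<mu> u = \<mu> (u$1 *s axis 1 1 + u$2 *s axis 2 1 + u$3 *s axis 3 1)"
      by (rule arg_cong[of _ _ \<mu>]) (simp add: vec_eq_iff forall_3 axis_def)
    thus ?thesis
      unfolding \<mu>_add \<mu>_scale by (simp add: M_def zorn_component_simps)
  qed
  \<comment> \<open>The product of (0, u, 0, 0) and (0, 0, v, 0) is a multiple of the idempotent,
    whose image has first entry 0. The Leibniz rule then makes \<open>\<nu>\<close> the negative
    transpose of \<open>\<mu>\<close>.\<close>
  have \<nu>: "\<nu> v = - (transpose M *v v)" for v
  proof -
    have "\<nu> v $ j = - (\<Sum>i\<in>UNIV. M $ i $ j * v $ i)" for j
    proof -
      have "D (zorn_mult (0, axis j 1, 0, 0) (0, 0, v, 0)) = zorn_scale (v $ j) (D (1, 0, 0, 0))"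
        unfolding scale[symmetric] using exhaust_3[of j] by (auto simp: zorn_dot_def sum_3 axis_def)
      hence "fst (D (zorn_mult (0, axis j 1, 0, 0) (0, 0, v, 0))) = 0" by (simp add: De)
      thus ?thesis
        unfolding mult Du Dv using exhaust_3[of j]
        by (auto simp: zorn_dot_def sum_3 M_def axis_def eq_neg_iff_add_eq_0 algebra_simps)
    qed
    thus ?thesis by (simp add: vec_eq_iff matrix_vector_mult_def transpose_def sum_negf)
  qed
  \<comment> \<open>The first two unit vectors of one Peirce component multiply to minus the third
    unit vector of the other; the Leibniz rule for this product gives the trace.\<close>
  have "trace M = 0"
  proof -
    have "zorn_mult (0, axis 1 1, 0, 0) (0, axis 2 1, 0, 0) = (0, 0, - axis 3 (1::'a), 0)"
      by (simp add: zorn_component_simps axis_def)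
    hence "\<nu> (- axis 3 1) $ 3 = fst (snd (snd (D (zorn_mult (0, axis 1 1, 0, 0) (0, axis 2 1, 0, 0))))) $ 3"
      by (simp add: \<nu>_def)
    thus ?thesis
      unfolding mult Du \<nu> \<mu>
      by (simp add: zorn_component_simps trace_def axis_def algebra_simps eq_neg_iff_add_eq_0 add.commute)
  qed
  moreover have "D = zder M r s"
  proof
    fix w :: "'a zorn"
    obtain a u v b where w: "w = (a, u, v, b)" by (cases w) auto
    have "D w = D (zorn_scale a (1, 0, 0, 0) + (0, u, 0, 0) + (0, 0, v, 0) + zorn_scale b (0, 0, 0, 1))"
      by (simp add: w)
    thus "D w = zder M r s w"
      unfolding add scale De Df Du Dv \<mu> \<nu> by (simp add: w zder_def vec_eq_iff algebra_simps)
  qed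
  ultimately   show "D \<in> {zder M r s | M r s. trace M = 0}" by blast
next
  fix D :: "'a zorn \<Rightarrow> 'a zorn"
  assume "D \<in> {zder M r s | M r s. trace M = 0}"
  thus "D \<in> split_g2" using zder_in_split_g2 by blast
qed

section \<open>Simplicity of the derivation algebra\<close>

definition mat_unit :: "3 \<Rightarrow> 3 \<Rightarrow> 'a::comm_ring_1 \<Rightarrow> 'a^3^3" where
  "mat_unit i j c = (\<chi> k l. if k = i \<and> l = j then c else 0)"

lemma trace_mat_unit: "i \<noteq> j \<Longrightarrow> trace (mat_unit i j c) = 0"
  using exhaust_3[of i] exhaust_3[of j] by (auto simp: trace_def mat_unit_def sum_3)

lemma trace_zero [simp]: "trace (0::'a::comm_ring_1^3^3) = 0"
  by (simp add: trace_def)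

lemma exists_other_3: "\<exists>j. j \<noteq> (i::3)"
  by (metis zero_neq_one)

lemma axis_zero [simp]: "axis i 0 = 0"
  by (simp add: axis_def vec_eq_iff)

lemma commutator_mat_unit:
  assumes ij: "i \<noteq> j" and tr: "trace M = (0::'a::comm_ring_1)"
  shows "commutator (zder (mat_unit i j c) 0 0) (zder M r s) =
    zder (\<chi> k l. (if k = i then c * M $ j $ l else 0) - (if l = j then c * M $ k $ i else 0))
      (axis i (c * r $ j)) (axis j (- c * s $ i))"
  unfolding commutator_zder[OF trace_mat_unit[OF ij] tr] zder_eq_iff
  using ij exhaust_3[of i] exhaust_3[of j]
  by (elim disjE) (simp_all add: mat_unit_def axis_def zorn_vec_simps)

text \<open>Brackets with the root vectors \<open>mat_unit i j\<close> and \<open>axis i 1\<close> turn any nonzero entry of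
  \<open>M\<close>, \<open>r\<close> or \<open>s\<close> into an off-diagonal entry of the matrix component, and squaring
  \<open>ad (mat_unit i j)\<close> isolates such an entry.\<close>

lemma split_g2_ideal:
  fixes N :: "('a::field_char_0 zorn \<Rightarrow> 'a zorn) set"
  assumes sub: "N \<subseteq> split_g2"
    and scale: "\<And>c D. D \<in> N \<Longrightarrow> zorn_op_scale c D \<in> N"
    and ideal: "\<And>X D. X \<in> split_g2 \<Longrightarrow> D \<in> N \<Longrightarrow> commutator X D \<in> N"
    and nz: "D \<in> N" "D \<noteq> zder 0 0 0"
  shows "zder 0 (axis k 1) 0 \<in> N"
proof -
  have unit: "zder (mat_unit i j c) 0 0 \<in> split_g2" if "i \<noteq> j" for i j c
    using zder_in_split_g2 trace_mat_unit[OF that] by blast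
  have step: "zder 0 (axis k 1) 0 \<in> N" if D: "zder 0 (axis i 1) 0 \<in> N" for i k
  proof (cases "k = i")
    case False
    have "zder 0 (axis k 1) 0 = commutator (zder (mat_unit k i 1) 0 0) (zder 0 (axis i (1::'a)) 0)"
      using False by (simp add: commutator_mat_unit zder_eq_iff vec_eq_iff)
    thus ?thesis using ideal[OF unit[OF False] D] by simp
  qed (use D in simp)
  have off: "zder 0 (axis k 1) 0 \<in> N"
    if D: "zder M r s \<in> N" and tr: "trace M = 0" and ij: "i \<noteq> j" and "M $ j $ i \<noteq> 0" for M r s i j
  proof -
    let ?E = "zder (mat_unit i j 1) 0 0 :: 'a zorn \<Rightarrow> 'a zorn"
    have "trace (\<chi> k l. (if k = i then 1 * M $ j $ l else 0) - (if l = j then 1 * M $ k $ i else 0)) = 0"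
      using ij by (simp add: trace_def sum_subtractf)
    \<comment> \<open>An off-diagonal matrix unit E has square zero, so applying its adjoint action
      twice sends \<open>M\<close> to - 2 E M E and kills \<open>r\<close> and
      \<open>s\<close>.\<close>
    hence "commutator ?E (commutator ?E (zder M r s)) = zder (mat_unit i j (- 2 * M $ j $ i)) 0 0"
      using ij by (simp add: commutator_mat_unit tr zder_eq_iff)
        (auto simp: mat_unit_def vec_eq_iff axis_def)
    hence E: "zder (mat_unit i j (- 2 * M $ j $ i)) 0 0 \<in> N"
      using ideal[OF unit[OF ij] ideal[OF unit[OF ij] D]] by metis
    \<comment> \<open>The scalar cancels \<open>- 2 * M $ j $ i\<close>; the remaining sign comes
      from the order of the commutator.\<close>
    have "zder 0 (axis j (1 / (2 * M $ j $ i))) 0 \<in> split_g2"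
      by (rule zder_in_split_g2) simp
    moreover have "commutator (zder 0 (axis j (1 / (2 * M $ j $ i))) 0) (zder (mat_unit i j (- 2 * M $ j $ i)) 0 0)
      = zder 0 (axis i 1) 0" (is "commutator ?X ?Y = _")
    proof -
      have "commutator ?X ?Y = - commutator ?Y ?X" by (simp add: commutator_def fun_eq_iff)
      also have "\<dots> = - zder 0 (axis i (- 1)) 0"
        using \<open>M $ j $ i \<noteq> 0\<close> ij by (simp add: commutator_mat_unit zder_eq_iff vec_eq_iff axis_def)
      also have "\<dots> = zder 0 (axis i 1) 0"
        by (simp add: fun_eq_iff zorn_component_simps axis_def)
      finally show ?thesis .
    qed
    ultimately have "zder 0 (axis i 1) 0 \<in> N" using ideal E by metis
    thus ?thesis by (rule step)
  qed
  obtain M r s where D: "D = zder M r s" and tr: "trace M = 0"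
    using nz(1) sub by (auto simp: split_g2_eq)
  \<comment> \<open>A bracket with an element without matrix part moves entries of \<open>s\<close>
    and \<open>r\<close> to off-diagonal positions, where \<open>off\<close> applies.\<close>
  have X: "\<exists>M' r' s'. zder M' r' s' \<in> N \<and> trace M' = 0 \<and> M' $ i $ j = - 3 * a $ i * s $ j + 3 * r $ i * b $ j"
    if "i \<noteq> j" for i j a b
  proof -
    have "commutator (zder 0 a b) D \<in> N"
      using ideal nz(1) zder_in_split_g2 trace_zero by blast
    moreover from this obtain M' r' s' where *: "commutator (zder 0 a b) D = zder M' r' s'" "trace M' = 0"
      using sub by (auto simp: split_g2_eq)
    moreover have "M' $ i $ j = - 3 * a $ i * s $ j + 3 * r $ i * b $ j"
      using *(1) that unfolding D commutator_zder[OF trace_zero tr] zder_eq_iff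
      by (auto simp: matrix_matrix_mult_def)
    ultimately show ?thesis by metis
  qed
  \<comment> \<open>If the last two alternatives fail, \<open>M\<close> is a scalar matrix, hence
    zero by its trace in characteristic 0.\<close>
  consider i where "s $ i \<noteq> 0" | i where "r $ i \<noteq> 0" | i j where "i \<noteq> j" "M $ i $ i \<noteq> M $ j $ j"
    | i j where "i \<noteq> j" "M $ i $ j \<noteq> 0"
  proof -
    have "M = 0" if "\<And>i j. i \<noteq> j \<Longrightarrow> M $ i $ i = M $ j $ j \<and> M $ i $ j = 0"
    proof -
      have "M $ 1 $ 1 = M $ 3 $ 3" "M $ 2 $ 2 = M $ 3 $ 3" using that by simp_all
      hence "3 * M $ 3 $ 3 = 0" using tr by (simp add: trace_def sum_3)
      hence "M $ i $ j = 0" for i j using that[of i 3] that[of i j] by (cases "i = j"; cases "i = 3") auto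
      thus ?thesis by (simp add: vec_eq_iff)
    qed
    thus thesis using that nz(2) unfolding D by (metis vec_eq_iff zero_index)
  qed
  thus ?thesis
  proof cases
    case 1
    obtain j where "j \<noteq> i" using exists_other_3 by blast
    with X[of j i "axis j 1" 0] obtain M' r' s'
      where "zder M' r' s' \<in> N" "trace M' = 0" "M' $ j $ i = - 3 * s $ i" by auto
    with \<open>j \<noteq> i\<close> 1 show ?thesis
      by (intro off[of M' r' s' i j]) auto
  next
    case 2
    obtain j where "j \<noteq> i" using exists_other_3 by blast
    with X[of i j 0 "axis j 1"] obtain M' r' s'
      where "zder M' r' s' \<in> N" "trace M' = 0" "M' $ i $ j = 3 * r $ i" by auto
    with \<open>j \<noteq> i\<close> 2 show ?thesis
      by (intro off[of M' r' s' j i]) auto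
  next
    \<comment> \<open>The bracket with the matrix unit has (i, j) entry
      \<open>M $ j $ j - M $ i $ i\<close>.\<close>
    case 3
    have "commutator (zder (mat_unit i j 1) 0 0) D \<in> N"
      using ideal unit[OF 3(1)] nz(1) by blast
    moreover have "trace (\<chi> k l. (if k = i then 1 * M $ j $ l else 0) - (if l = j then 1 * M $ k $ i else 0)) = 0"
      using 3 by (simp add: trace_def sum_subtractf)
    ultimately show ?thesis
      unfolding D commutator_mat_unit[OF 3(1) tr]
      by (rule off[of _ _ _ j i]) (use 3 in auto)
  next
    case 4
    thus ?thesis using off[of M r s j i] nz(1) tr D by auto
  qed
qed

section \<open>A root basis and its generation by three short root vectors\<close>

definition mat3 :: "'a::comm_ring_1 \<Rightarrow> 'a \<Rightarrow> 'a \<Rightarrow> 'a \<Rightarrow> 'a \<Rightarrow> 'a \<Rightarrow> 'a \<Rightarrow> 'a \<Rightarrow> 'a \<Rightarrow> 'a^3^3" where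
  "mat3 a b c d e f g h i = vector [vector [a, b, c], vector [d, e, f], vector [g, h, i]]"

text \<open>The derivations that act as \<open>S1\<close>, ..., \<open>S6\<close>, \<open>h1\<close>, \<open>h2\<close>, \<open>L1\<close>, ..., \<open>L6\<close>, with \<open>\<rho>\<close> in the
  role of the square root of 3.\<close>

definition g2_basis :: "'a::field_char_0 \<Rightarrow> ('a zorn \<Rightarrow> 'a zorn) list" where
  "g2_basis \<rho> =
    [zder 0 (vector [- 8, 0, 0]) 0, zder 0 (vector [0, 1/8, 0]) 0, zder 0 (vector [0, 0, - 1]) 0,
     zder 0 0 (vector [0, 0, 2]), zder 0 0 (vector [1/4, 0, 0]), zder 0 0 (vector [0, - 16, 0]),
     zder (mat3 1 0 0 0 (- 1/2) 0 0 0 (- 1/2)) 0 0,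
     zder (mat3 0 0 0 0 (\<rho>/2) 0 0 0 (- \<rho>/2)) 0 0,
     zder (mat3 0 0 48 0 0 0 0 0 0) 0 0, zder (mat3 0 0 0 0 0 (- 3/4) 0 0 0) 0 0,
     zder (mat3 0 0 0 (- 3/32) 0 0 0 0 0) 0 0, zder (mat3 0 0 0 0 0 0 (3/4) 0 0) 0 0,
     zder (mat3 0 0 0 0 0 0 0 (- 48) 0) 0 0, zder (mat3 0 (- 384) 0 0 0 0 0 0 0) 0 0]"

lemma zder_add: "zder M r s + zder M' r' s' = zder (M + M') (r + r') (s + s')"
  by (rule ext) (auto simp: zorn_component_simps algebra_simps)

lemma zorn_op_scale_zder:
  "zorn_op_scale c (zder M r s) = zder (\<chi> i j. c * M $ i $ j) (c *s r) (c *s s)"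
  by (rule ext) (auto simp: zorn_op_scale_def zorn_component_simps algebra_simps)

lemma sum_lessThan_14:
  "(\<Sum>i<14::nat. f i) = f 0 + f 1 + f 2 + f 3 + f 4 + f 5 + f 6 + f 7 + f 8 + f 9 + f 10 + f 11 + f 12 + f 13"
  by (simp add: eval_nat_numeral)

lemma g2_basis_comb:
  "(\<Sum>i<14. zorn_op_scale (c i) (g2_basis \<rho> ! i)) =
   zder (mat3 (c 6) (- 384 * c 13) (48 * c 8)
              (- 3/32 * c 10) (- c 6/2 + \<rho>/2 * c 7) (- 3/4 * c 9)
              (3/4 * c 11) (- 48 * c 12) (- c 6/2 - \<rho>/2 * c 7))
     (vector [- 8 * c 0, c 1/8, - c 2]) (vector [c 4/4, - 16 * c 5, 2 * c 3])"
  by (simp add: sum_lessThan_14 g2_basis_def zorn_op_scale_zder zder_add zder_eq_iff)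
    (simp add: vec_eq_iff forall_3 mat3_def)

lemma length_g2_basis [simp]: "length (g2_basis \<rho>) = 14"
  by (simp add: g2_basis_def)

lemma g2_basis_independent:
  assumes "\<rho> \<noteq> 0" "(\<Sum>i<14. zorn_op_scale (c i) (g2_basis \<rho> ! i)) = 0" "i < 14"
  shows "c i = 0"
proof -
  have "zder 0 0 0 = 0" by (rule ext) (auto simp: zorn_component_simps zero_prod_def)
  hence "zder (mat3 (c 6) (- 384 * c 13) (48 * c 8)
              (- 3/32 * c 10) (- c 6/2 + \<rho>/2 * c 7) (- 3/4 * c 9)
              (3/4 * c 11) (- 48 * c 12) (- c 6/2 - \<rho>/2 * c 7))
     (vector [- 8 * c 0, c 1/8, - c 2]) (vector [c 4/4, - 16 * c 5, 2 * c 3]) = zder 0 0 0"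
    using assms(2) unfolding g2_basis_comb by simp
  hence "\<forall>i\<in>{0,1,2,3,4,5,6,7,8,9,10,11,12,13}. c i = 0"
    using assms(1) unfolding zder_eq_iff by (auto simp: vec_eq_iff forall_3 mat3_def)
  moreover have "i \<in> {0,1,2,3,4,5,6,7,8,9,10,11,12,13}"
    using assms(3) unfolding insert_iff empty_iff by presburger
  ultimately show ?thesis by blast
qed

lemma g2_basis_span:
  assumes "\<rho> \<noteq> 0" "D \<in> split_g2"
  obtains c where "D = (\<Sum>i<14. zorn_op_scale (c i) (g2_basis \<rho> ! i))"
proof -
  obtain M r s where D: "D = zder M r s" and "trace M = 0"
    using assms by (auto simp: split_g2_eq)
  hence M33: "M$3$3 = - M$1$1 - M$2$2"
    by (simp add: trace_def sum_3 algebra_simps add_eq_0_iff)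
  let ?c = "(!) [- r$1/8, 8 * r$2, - r$3, s$3/2, 4 * s$1, - s$2/16, M$1$1, (2 * M$2$2 + M$1$1)/\<rho>,
    M$1$3/48, - 4/3 * M$2$3, - 32/3 * M$2$1, 4/3 * M$3$1, - M$3$2/48, - M$1$2/384]"
  have "D = (\<Sum>i<14. zorn_op_scale (?c i) (g2_basis \<rho> ! i))"
    unfolding D g2_basis_comb zder_eq_iff using assms(1)
    by (simp add: vec_eq_iff forall_3 mat3_def M33) (simp add: field_simps)
  thus thesis by (rule that)
qed

lemma split_g2_scale:
  fixes D :: "'a::field_char_0 zorn \<Rightarrow> 'a zorn"
  assumes "D \<in> split_g2"
  shows "zorn_op_scale c D \<in> split_g2"
proof -
  obtain M r s where D: "D = zder M r s" "trace M = 0" using assms by (auto simp: split_g2_eq)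
  show ?thesis
    unfolding D zorn_op_scale_zder
    by (rule zder_in_split_g2) (use D(2) in \<open>simp add: trace_def sum_distrib_left[symmetric]\<close>)
qed

lemma split_g2_closed:
  fixes D D' :: "'a::field_char_0 zorn \<Rightarrow> 'a zorn"
  assumes "D \<in> split_g2" "D' \<in> split_g2"
  shows "D + D' \<in> split_g2" "commutator D D' \<in> split_g2"
proof -
  obtain M r s M' r' s' where D: "D = zder M r s" "trace M = 0" "D' = zder M' r' s'" "trace M' = 0"
    using assms by (auto simp: split_g2_eq)
  show "D + D' \<in> split_g2"
    unfolding D zder_add by (rule zder_in_split_g2) (simp add: trace_add D)
  show "commutator D D' \<in> split_g2"
    unfolding D(1,3) commutator_zder[OF D(2,4)]
    by (rule zder_in_split_g2) (simp add: trace_def zorn_vec_simps algebra_simps)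
qed

lemma commutator_lie:
  fixes A B C :: "'a::field_char_0 zorn \<Rightarrow> 'a zorn"
  assumes "A \<in> split_g2" "B \<in> split_g2" "C \<in> split_g2"
  shows "commutator (A + B) C = commutator A C + commutator B C"
    and "commutator C (A + B) = commutator C A + commutator C B"
    and "commutator A (commutator B C) + commutator B (commutator C A) + commutator C (commutator A B) = 0"
proof -
  note lin = split_g2_derivation(1,2)[OF assms(1)] split_g2_derivation(1,2)[OF assms(2)] split_g2_derivation(1,2)[OF assms(3)]
  have diff: "D (x - y) = D x - D y" if "D \<in> split_g2" for D :: "'a zorn \<Rightarrow> 'a zorn" and x y
    using split_g2_derivation(1)[OF that, of "x - y" y] by simp
  show "commutator (A + B) C = commutator A C + commutator B C"
    "commutator C (A + B) = commutator C A + commutator C B"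
    by (simp_all add: commutator_def fun_eq_iff lin)
  show "commutator A (commutator B C) + commutator B (commutator C A) + commutator C (commutator A B) = 0"
    by (simp add: commutator_def fun_eq_iff diff assms)
qed

lemma commutator_scale:
  fixes A B :: "'a::field_char_0 zorn \<Rightarrow> 'a zorn"
  assumes "A \<in> split_g2" "B \<in> split_g2"
  shows "commutator (zorn_op_scale c A) B = zorn_op_scale c (commutator A B)"
    and "commutator A (zorn_op_scale c B) = zorn_op_scale c (commutator A B)"
proof -
  interpret vector_space "zorn_scale :: 'a \<Rightarrow> _" by (rule vector_space_zorn_scale)
  show "commutator (zorn_op_scale c A) B = zorn_op_scale c (commutator A B)"
    "commutator A (zorn_op_scale c B) = zorn_op_scale c (commutator A B)"
    by (simp_all add: commutator_def zorn_op_scale_def fun_eq_iff scale_right_diff_distrib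
        split_g2_derivation(2)[OF assms(1)] split_g2_derivation(2)[OF assms(2)])
qed

text \<open>Indexing coefficients by position lets one criterion yield distinctness as well: a
  repeated entry gives a relation with coefficients 1 and -1.\<close>

lemma (in vector_space) independent_list:
  assumes "\<And>c i. (\<Sum>i<length xs. scale (c i) (xs ! i)) = 0 \<Longrightarrow> i < length xs \<Longrightarrow> c i = 0"
  shows "distinct xs" "independent (set xs)"
proof -
  show dist: "distinct xs"
    unfolding distinct_conv_nth
  proof (intro allI impI notI)
    fix i j assume ij: "i < length xs" "j < length xs" "i \<noteq> j" "xs ! i = xs ! j"
    let ?c = "\<lambda>k. if k = i then 1 else if k = j then - 1 else 0"
    have "(\<Sum>k<length xs. scale (?c k) (xs ! k)) = (\<Sum>k\<in>{i, j}. scale (?c k) (xs ! k))"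
      using ij by (intro sum.mono_neutral_right) auto
    also have "\<dots> = 0" using ij by simp
    finally show False using assms[of ?c i] ij by simp
  qed
  show "independent (set xs)"
  proof (rule ccontr)
    assume "\<not> independent (set xs)"
    then obtain u v where uv: "v \<in> set xs" "u v \<noteq> 0" "(\<Sum>v\<in>set xs. scale (u v) v) = 0"
      using dependent_finite[of "set xs"] by auto
    have "(\<Sum>i<length xs. scale (u (xs ! i)) (xs ! i)) = (\<Sum>v\<in>set xs. scale (u v) v)"
      using dist by (intro sum.reindex_bij_betw bij_betw_nth) auto
    with uv assms[of "\<lambda>i. u (xs ! i)"] show False by (auto simp: in_set_conv_nth)
  qed
qed

text \<open>Diagonal matrices act diagonally: the weights are differences of diagonal entries on the
  matrix part and, up to sign, the entries themselves on \<open>r\<close> and \<open>s\<close>. The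
  root eigenvalues and the self-normalising property of the torus are read off from here.\<close>

lemma commutator_diagonal:
  fixes a b :: "'a::comm_ring_1"
  assumes "trace M = 0"
  shows "commutator (zder (mat3 a 0 0 0 b 0 0 0 (- a - b)) 0 0) (zder M r s) =
    zder (mat3 0 ((a - b) * M$1$2) ((2 * a + b) * M$1$3)
      ((b - a) * M$2$1) 0 ((a + 2 * b) * M$2$3)
      (- (2 * a + b) * M$3$1) (- (a + 2 * b) * M$3$2) 0)
      (vector [a * r$1, b * r$2, (- a - b) * r$3]) (vector [- a * s$1, - b * s$2, (a + b) * s$3])"
proof -
  have "trace (mat3 a 0 0 0 b 0 0 0 (- a - b)) = 0"
    by (simp add: mat3_def trace_def sum_3)
  thus ?thesis
    using assms by (subst commutator_zder)
      (simp_all add: zder_eq_iff mat3_def zorn_vec_simps algebra_simps)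
qed

lemma g2_basis_in_split_g2: "set (g2_basis \<rho>) \<subseteq> split_g2"
  unfolding g2_basis_def by (auto intro!: zder_in_split_g2 simp: trace_def mat3_def sum_3)

text \<open>For generators t1 e1, t2 e2, t3 e3 the last two brackets are t1 t2 t3 times the
  displayed matrices. Since (-8)(1/8)(-1) = 1, they have the normalisation that the prescribed roots
  demand.\<close>

lemma g2_commutators:
  defines "D1 \<equiv> zder 0 (vector [- 8, 0, 0]) 0 :: 'a::field_char_0 zorn \<Rightarrow> 'a zorn"
    and "D2 \<equiv> zder 0 (vector [0, 1/8, 0]) 0 :: 'a zorn \<Rightarrow> 'a zorn"
    and "D3 \<equiv> zder 0 (vector [0, 0, - 1]) 0 :: 'a zorn \<Rightarrow> 'a zorn"
    and "D4 \<equiv> zder 0 0 (vector [0, 0, 2]) :: 'a zorn \<Rightarrow> 'a zorn"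
    and "D5 \<equiv> zder 0 0 (vector [1/4, 0, 0]) :: 'a zorn \<Rightarrow> 'a zorn"
    and "D6 \<equiv> zder 0 0 (vector [0, - 16, 0]) :: 'a zorn \<Rightarrow> 'a zorn"
  shows "commutator D1 D2 = D4" "commutator D2 D3 = D5" "commutator D3 D1 = D6"
    "commutator D1 D4 = zder (mat3 0 0 48 0 0 0 0 0 0) 0 0"
    "commutator D2 D4 = zder (mat3 0 0 0 0 0 (- 3/4) 0 0 0) 0 0"
    "commutator D2 D5 = zder (mat3 0 0 0 (- 3/32) 0 0 0 0 0) 0 0"
    "commutator D3 D5 = zder (mat3 0 0 0 0 0 0 (3/4) 0 0) 0 0"
    "commutator D3 D6 = zder (mat3 0 0 0 0 0 0 0 (- 48) 0) 0 0"
    "commutator D1 D6 = zder (mat3 0 (- 384) 0 0 0 0 0 0 0) 0 0"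
    "commutator D2 D6 = zder (mat3 (- 2) 0 0 0 4 0 0 0 (- 2)) 0 0"
    "commutator D4 D3 = zder (mat3 2 0 0 0 2 0 0 0 (- 4)) 0 0"
  unfolding D1_def D2_def D3_def D4_def D5_def D6_def
  by (simp_all add: commutator_zder zder_eq_iff mat3_def zorn_vec_simps)

text \<open>The last diagonal entry is left in the form - a - b so that
  \<open>commutator_diagonal\<close> applies by rewriting.\<close>

lemma g2_cartan_elements:
  fixes \<rho> :: "'a::field_char_0"
  shows "zder (mat3 1 0 0 0 (- 1/2) 0 0 0 (- 1 - (- 1/2))) 0 0 =
      zorn_op_scale (1/4) (zder (mat3 2 0 0 0 2 0 0 0 (- 4)) 0 0 - zder (mat3 (- 2) 0 0 0 4 0 0 0 (- 2)) 0 (0::'a^3))"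
    and "zder (mat3 0 0 0 0 (\<rho>/2) 0 0 0 (- 0 - \<rho>/2)) 0 0 =
      zorn_op_scale (\<rho>/12) (zder (mat3 2 0 0 0 2 0 0 0 (- 4)) 0 0 + zder (mat3 (- 2) 0 0 0 4 0 0 0 (- 2)) 0 0)"
  by (auto simp: fun_eq_iff zorn_op_scale_def zorn_component_simps mat3_def algebra_simps)

text \<open>Brackets of at most three generators already produce all root vectors and both Cartan
  directions. The lemma is applied to the set of derivations that lift to vector fields.\<close>

lemma split_g2_generated:
  fixes S :: "('a::field_char_0 zorn \<Rightarrow> 'a zorn) set"
  assumes add: "\<And>D D'. D \<in> S \<Longrightarrow> D' \<in> S \<Longrightarrow> D + D' \<in> S"
    and scale: "\<And>c D. D \<in> S \<Longrightarrow> zorn_op_scale c D \<in> S"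
    and comm: "\<And>D D'. D \<in> S \<Longrightarrow> D' \<in> S \<Longrightarrow> commutator D D' \<in> S"
    and gen: "zder 0 (vector [- 8, 0, 0]) 0 \<in> S" "zder 0 (vector [0, 1/8, 0]) 0 \<in> S"
      "zder 0 (vector [0, 0, - 1]) 0 \<in> S"
  shows "split_g2 \<subseteq> S"
proof
  interpret VZ: vector_space "zorn_op_scale :: 'a \<Rightarrow> _" by (rule vector_space_zorn_op_scale)
  fix D :: "'a zorn \<Rightarrow> 'a zorn" assume "D \<in> split_g2"
  \<comment> \<open>The parameter 1 serves here: rescaling the second Cartan element does not affect
    spanning, so no square root of 3 has to exist in the field.\<close>
  then obtain c where c: "D = (\<Sum>i<14. zorn_op_scale (c i) (g2_basis 1 ! i))"
    using g2_basis_span[of 1] by auto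
  note com = g2_commutators[where 'a = 'a]
  note mem1 = comm[OF gen(1,2), unfolded com] comm[OF gen(2,3), unfolded com] comm[OF gen(3,1), unfolded com]
  note mem2 = comm[OF gen(1) mem1(1), unfolded com] comm[OF gen(2) mem1(1), unfolded com]
    comm[OF gen(2) mem1(2), unfolded com] comm[OF gen(3) mem1(2), unfolded com]
    comm[OF gen(3) mem1(3), unfolded com] comm[OF gen(1) mem1(3), unfolded com]
    comm[OF gen(2) mem1(3), unfolded com] comm[OF mem1(1) gen(3), unfolded com]
  have "A - B \<in> S" if "A \<in> S" "B \<in> S" for A B
    using add[OF that(1) scale[OF that(2), of "- 1"]] by simp
  hence "set (g2_basis 1) \<subseteq> S"
    using gen mem1 mem2 add scale g2_cartan_elements(1)[where 'a = 'a] g2_cartan_elements(2)[of "1::'a"]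
    by (simp add: g2_basis_def)
  \<comment> \<open>The induction starts at one summand because \<open>0\<close> is not among the
    assumed members of \<open>S\<close>.\<close>
  moreover have "(\<Sum>i<n. zorn_op_scale (c i) (g2_basis 1 ! i)) \<in> S" if "0 < n" "n \<le> 14" for n
    using that
  proof (induction n)
    case (Suc n)
    have "g2_basis 1 ! n \<in> S" using Suc calculation nth_mem[of n "g2_basis 1"] by auto
    hence "zorn_op_scale (c n) (g2_basis 1 ! n) \<in> S" by (rule scale)
    thus ?case
      using Suc by (cases "n = 0") (simp, unfold sum.lessThan_Suc, intro add, simp_all)
  qed simp
  ultimately show "D \<in> S" unfolding c by simp
qed

section \<open>Transport of the Lie algebra structure along an injective homomorphism into vector
  fields\<close>

locale split_g2_embedding =
  fixes U :: "(real^5) set" and \<Psi> :: "('a::real_normed_field zorn \<Rightarrow> 'a zorn) \<Rightarrow> real^5 \<Rightarrow> 'a^5"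
  assumes add: "D \<in> split_g2 \<Longrightarrow> D' \<in> split_g2 \<Longrightarrow> \<Psi> (D + D') = \<Psi> D + \<Psi> D'"
    and scale: "D \<in> split_g2 \<Longrightarrow> \<Psi> (zorn_op_scale c D) = field_scale c (\<Psi> D)"
    and bracket: "D \<in> split_g2 \<Longrightarrow> D' \<in> split_g2 \<Longrightarrow>
      field_bracket U (\<Psi> D) (\<Psi> D') = \<Psi> (commutator D D')"
    and inj: "inj_on \<Psi> split_g2"
    and smooth: "D \<in> split_g2 \<Longrightarrow> \<Psi> D \<in> vector_fields U"
begin

sublocale VF: vector_space "field_scale :: 'a \<Rightarrow> _" by (rule vector_space_field_scale)
sublocale VZ: vector_space "zorn_op_scale :: 'a \<Rightarrow> _" by (rule vector_space_zorn_op_scale)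

lemma zero_in [simp]: "(0 :: 'a zorn \<Rightarrow> 'a zorn) \<in> split_g2"
proof -
  have "zder 0 0 0 = (0 :: 'a zorn \<Rightarrow> 'a zorn)" by (rule ext) (auto simp: zorn_component_simps zero_prod_def)
  thus ?thesis by (metis zder_in_split_g2 trace_zero)
qed

lemma zero: "\<Psi> 0 = 0"
  using add[of 0 0] by simp

lemma eq_iff: "D \<in> split_g2 \<Longrightarrow> D' \<in> split_g2 \<Longrightarrow> \<Psi> D = \<Psi> D' \<longleftrightarrow> D = D'"
  using inj by (auto simp: inj_on_def)

lemma diff: "D \<in> split_g2 \<Longrightarrow> D' \<in> split_g2 \<Longrightarrow> \<Psi> (D - D') = \<Psi> D - \<Psi> D'"
  using add[of D "zorn_op_scale (- 1) D'"] scale[of D' "- 1"] split_g2_scale[of D' "- 1"]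
  by simp

text \<open>Stated for a subset \<open>T\<close> because it serves both the full algebra and the
  torus.\<close>

lemma lie_algebra_image:
  assumes T: "T \<subseteq> split_g2" and "0 \<in> T"
    and "\<And>x y. x \<in> T \<Longrightarrow> y \<in> T \<Longrightarrow> x + y \<in> T" "\<And>c x. x \<in> T \<Longrightarrow> zorn_op_scale c x \<in> T"
    and "\<And>x y. x \<in> T \<Longrightarrow> y \<in> T \<Longrightarrow> commutator x y \<in> T"
  shows "VF.subspace (\<Psi> ` T)" "lie_algebra field_scale (\<Psi> ` T) (field_bracket U)"
proof -
  have in_T: "D \<in> split_g2" if "D \<in> T" for D using that T by blast
  note simps = in_T bracket split_g2_closed split_g2_scale commutator_lie
    add[symmetric] scale[symmetric]
  show sub: "VF.subspace (\<Psi> ` T)"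
    unfolding VF.subspace_def using assms zero
    by (auto simp: in_T add[symmetric] scale[symmetric] intro!: imageI split_g2_scale)
  show "lie_algebra field_scale (\<Psi> ` T) (field_bracket U)"
  proof (unfold_locales, rule sub)
    fix x y z assume "x \<in> \<Psi> ` T" "y \<in> \<Psi> ` T" "z \<in> \<Psi> ` T"
    then obtain X Y Z where *: "x = \<Psi> X" "y = \<Psi> Y" "z = \<Psi> Z" "X \<in> T" "Y \<in> T" "Z \<in> T" by blast
    show "field_bracket U (x + y) z = field_bracket U x z + field_bracket U y z"
      "field_bracket U x (y + z) = field_bracket U x y + field_bracket U x z"
      using *(4-6) by (simp_all add: * simps)
    show "field_bracket U x (field_bracket U y z) + field_bracket U y (field_bracket U z x)
      + field_bracket U z (field_bracket U x y) = 0"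
      using *(4-6) by (simp add: * simps zero)
  next
    fix c x y assume "x \<in> \<Psi> ` T" "y \<in> \<Psi> ` T"
    then obtain X Y where *: "x = \<Psi> X" "y = \<Psi> Y" "X \<in> T" "Y \<in> T" by blast
    show "field_bracket U x y \<in> \<Psi> ` T"
      using *(3-4) assms(5) by (simp add: * in_T bracket)
    show "field_bracket U (field_scale c x) y = field_scale c (field_bracket U x y)"
      "field_bracket U x (field_scale c y) = field_scale c (field_bracket U x y)"
      using *(3-4) commutator_scale[of X Y] by (simp_all add: * simps)
  next
    fix x assume "x \<in> \<Psi> ` T"
    thus "field_bracket U x x = 0"
      by (auto simp: in_T bracket commutator_def zero[unfolded zero_fun_def] zero_fun_def)
  qed
qed

lemma sum:
  fixes n :: nat
  assumes "\<And>i. i < n \<Longrightarrow> D i \<in> split_g2"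
  shows "(\<Sum>i<n. zorn_op_scale (c i) (D i)) \<in> split_g2 \<and>
    \<Psi> (\<Sum>i<n. zorn_op_scale (c i) (D i)) = (\<Sum>i<n. field_scale (c i) (\<Psi> (D i)))"
  using assms by (induction n) (auto simp: zero add scale split_g2_closed split_g2_scale)

lemma span_image_basis:
  assumes "\<rho> \<noteq> 0"
  shows "VF.span (set (map \<Psi> (g2_basis \<rho>))) = \<Psi> ` split_g2"
proof
  show "VF.span (set (map \<Psi> (g2_basis \<rho>))) \<subseteq> \<Psi> ` split_g2"
    using g2_basis_in_split_g2 split_g2_closed split_g2_scale
    by (intro VF.span_minimal lie_algebra_image) auto
  show "\<Psi> ` split_g2 \<subseteq> VF.span (set (map \<Psi> (g2_basis \<rho>)))"
  proof
    fix x assume "x \<in> \<Psi> ` split_g2"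
    then obtain D where D: "x = \<Psi> D" "D \<in> split_g2" by blast
    obtain c where c: "D = (\<Sum>i<14. zorn_op_scale (c i) (g2_basis \<rho> ! i))"
      using g2_basis_span[OF assms D(2)] by blast
    have "x = (\<Sum>i<14. field_scale (c i) (\<Psi> (g2_basis \<rho> ! i)))"
      unfolding D c using sum[of 14 "(!) (g2_basis \<rho>)"] g2_basis_in_split_g2[of \<rho>] nth_mem[of _ "g2_basis \<rho>"]
      by force
    also have "\<dots> \<in> VF.span (set (map \<Psi> (g2_basis \<rho>)))"
      by (intro VF.span_sum VF.span_scale VF.span_base) (simp add: nth_mem)
    finally show "x \<in> VF.span (set (map \<Psi> (g2_basis \<rho>)))" .
  qed
qed

lemma independent_image_basis:
  assumes "\<rho> \<noteq> 0"
  shows "distinct (map \<Psi> (g2_basis \<rho>))" "VF.independent (set (map \<Psi> (g2_basis \<rho>)))"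
proof -
  have *: "c i = 0"
    if "(\<Sum>i<length (map \<Psi> (g2_basis \<rho>)). field_scale (c i) (map \<Psi> (g2_basis \<rho>) ! i)) = 0"
      "i < length (map \<Psi> (g2_basis \<rho>))" for c i
  proof -
    have mem: "g2_basis \<rho> ! i \<in> split_g2" if "i < 14" for i
      using g2_basis_in_split_g2[of \<rho>] nth_mem[of i "g2_basis \<rho>"] that by auto
    have "\<Psi> (\<Sum>i<14. zorn_op_scale (c i) (g2_basis \<rho> ! i)) = (\<Sum>i<14. field_scale (c i) (\<Psi> (g2_basis \<rho> ! i)))"
      using sum[where n = 14 and D = "(!) (g2_basis \<rho>)" and c = c, OF mem] by blast
    also have "\<dots> = \<Psi> 0" using that(1) by (simp add: zero)
    finally have "(\<Sum>i<14. zorn_op_scale (c i) (g2_basis \<rho> ! i)) = 0"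
      using sum[where n = 14 and D = "(!) (g2_basis \<rho>)" and c = c, OF mem] eq_iff zero_in by blast
    thus ?thesis using g2_basis_independent[OF assms] that(2) by simp
  qed
  show "distinct (map \<Psi> (g2_basis \<rho>))" "VF.independent (set (map \<Psi> (g2_basis \<rho>)))"
    by (rule VF.independent_list, erule (1) *)+
qed

lemma isomorphic: "lie_isomorphic field_scale (\<Psi> ` split_g2) (field_bracket U) zorn_op_scale (split_g2 :: ('a zorn \<Rightarrow> 'a zorn) set) commutator"
  unfolding lie_isomorphic_def
proof (intro exI[of _ "inv_into split_g2 \<Psi>"] conjI ballI allI)
  note [simp] = inv_into_f_f[OF inj] split_g2_closed split_g2_scale
  show "bij_betw (inv_into split_g2 \<Psi>) (\<Psi> ` split_g2) split_g2"
    using inj by (intro bij_betw_inv_into) (simp add: bij_betw_def)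
  fix x assume "x \<in> \<Psi> ` split_g2"
  then obtain D where D: "x = \<Psi> D" "D \<in> split_g2" by blast
  show "inv_into split_g2 \<Psi> (field_scale c x) = zorn_op_scale c (inv_into split_g2 \<Psi> x)" for c
    using D by (simp add: scale[symmetric])
  fix y assume "y \<in> \<Psi> ` split_g2"
  then obtain E where E: "y = \<Psi> E" "E \<in> split_g2" by blast
  show "inv_into split_g2 \<Psi> (x + y) = inv_into split_g2 \<Psi> x + inv_into split_g2 \<Psi> y"
    "inv_into split_g2 \<Psi> (field_bracket U x y) = commutator (inv_into split_g2 \<Psi> x) (inv_into split_g2 \<Psi> y)"
    using D E by (simp_all add: add[symmetric] bracket)
qed

definition torus :: "('a zorn \<Rightarrow> 'a zorn) set" where
  "torus = {zder (mat3 a 0 0 0 b 0 0 0 (- a - b)) 0 0 | a b. True}"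

text \<open>The torus is abelian, so its lower central series vanishes after one step; it contains a
  regular element, which forces its normaliser back into it.\<close>

lemma cartan_torus: "cartan_subalgebra field_scale (\<Psi> ` split_g2) (field_bracket U) (\<Psi> ` torus)"
proof -
  have sub: "torus \<subseteq> split_g2"
    by (auto simp: torus_def intro!: zder_in_split_g2) (simp add: mat3_def trace_def sum_3)
  have comm0: "commutator D D' = 0" if "D \<in> torus" "D' \<in> torus" for D D'
    using that unfolding torus_def
    by (auto simp: commutator_def fun_eq_iff zorn_component_simps mat3_def zero_prod_def)
  have T0: "0 \<in> torus"
    unfolding torus_def
    by (rule CollectI, rule exI[of _ 0], rule exI[of _ 0])
      (auto simp: fun_eq_iff zorn_component_simps mat3_def zero_prod_def)
  have lie: "lie_algebra field_scale (\<Psi> ` torus) (field_bracket U)"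
  proof (rule lie_algebra_image(2)[OF sub T0])
    fix x y :: "'a zorn \<Rightarrow> 'a zorn" and c assume "x \<in> torus" "y \<in> torus"
    then obtain a b a' b' where
      *: "x = zder (mat3 a 0 0 0 b 0 0 0 (- a - b)) 0 0" "y = zder (mat3 a' 0 0 0 b' 0 0 0 (- a' - b')) 0 0"
      by (auto simp: torus_def)
    show "x + y \<in> torus"
      unfolding torus_def * zder_add zder_eq_iff
      by (rule CollectI, rule exI[of _ "a + a'"], rule exI[of _ "b + b'"])
        (simp add: zder_eq_iff vec_eq_iff forall_3 mat3_def)
    show "zorn_op_scale c x \<in> torus"
      unfolding torus_def * zorn_op_scale_zder zder_eq_iff
      by (rule CollectI, rule exI[of _ "c * a"], rule exI[of _ "c * b"])
        (simp add: zder_eq_iff vec_eq_iff forall_3 mat3_def algebra_simps)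
    show "commutator x y \<in> torus" using comm0 T0 \<open>x \<in> torus\<close> \<open>y \<in> torus\<close> by simp
  qed
  have br0: "field_bracket U x y = 0" if "x \<in> \<Psi> ` torus" "y \<in> \<Psi> ` torus" for x y
    using that comm0 sub by (auto simp: bracket subset_iff zero)
  have "0 \<in> \<Psi> ` torus" using zero T0 by (metis imageI)
  have "{field_bracket U x y | x y. x \<in> \<Psi> ` torus \<and> y \<in> \<Psi> ` torus} = {0}" (is "?A = _")
  proof (rule equalityI)
    show "?A \<subseteq> {0}" using br0 by (auto simp del: image_iff)
    show "{0} \<subseteq> ?A"
      using br0[OF \<open>0 \<in> \<Psi> ` torus\<close> \<open>0 \<in> \<Psi> ` torus\<close>] \<open>0 \<in> \<Psi> ` torus\<close>
      by (simp del: image_iff) metis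
  qed
  hence nil: "lower_central_series field_scale (\<Psi> ` torus) (field_bracket U) 1 = {0}"
    by simp
  have norm: "D \<in> torus"
    if D: "D \<in> split_g2" and *: "\<forall>c\<in>\<Psi> ` torus. field_bracket U (\<Psi> D) c \<in> \<Psi> ` torus" for D
  proof -
    \<comment> \<open>For a = 1, b = 3 all of a, b, a + b, a - b, 2a + b, a + 2b are nonzero. So if
      the bracket of \<open>D\<close> with \<open>?h\<close> is diagonal, \<open>D\<close> has no
      off-diagonal entries and no \<open>r\<close>, \<open>s\<close>.\<close>
    let ?h = "zder (mat3 1 0 0 0 3 0 0 0 (- 1 - 3)) 0 0 :: 'a zorn \<Rightarrow> 'a zorn"
    have h: "?h \<in> torus" unfolding torus_def by blast
    with * have "\<Psi> (commutator D ?h) \<in> \<Psi> ` torus" using D sub by (auto simp: bracket subset_iff)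
    hence "commutator D ?h \<in> torus"
      using inj_on_image_mem_iff[OF inj _ sub] split_g2_closed(2)[OF D] h sub by blast
    moreover have "commutator D ?h = - commutator ?h D" by (simp add: commutator_def fun_eq_iff)
    moreover obtain M r s where M: "D = zder M r s" "trace M = 0" using D by (auto simp: split_g2_eq)
    ultimately obtain a b where eq: "- commutator ?h (zder M r s) = zder (mat3 a 0 0 0 b 0 0 0 (- a - b)) 0 0"
      by (auto simp: torus_def)
    have "commutator ?h (zder M r s) = zorn_op_scale (- 1) (zder (mat3 a 0 0 0 b 0 0 0 (- a - b)) 0 0)"
      unfolding eq[symmetric] by simp
    moreover have "M $ 3 $ 3 = - M $ 1 $ 1 - M $ 2 $ 2"
      using M(2) by (simp add: trace_def sum_3 algebra_simps add_eq_0_iff)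
    ultimately have "D = zder (mat3 (M$1$1) 0 0 0 (M$2$2) 0 0 0 (- M$1$1 - M$2$2)) 0 0"
      unfolding M commutator_diagonal[OF M(2)] zorn_op_scale_zder zder_eq_iff
      by (simp add: vec_eq_iff forall_3 mat3_def)
    thus ?thesis unfolding torus_def by blast
  qed
  have "{x \<in> \<Psi> ` split_g2. \<forall>c\<in>\<Psi> ` torus. field_bracket U x c \<in> \<Psi> ` torus} = \<Psi> ` torus"
  proof
    show "{x \<in> \<Psi> ` split_g2. \<forall>c\<in>\<Psi> ` torus. field_bracket U x c \<in> \<Psi> ` torus} \<subseteq> \<Psi> ` torus"
      using norm by auto
    show "\<Psi> ` torus \<subseteq> {x \<in> \<Psi> ` split_g2. \<forall>c\<in>\<Psi> ` torus. field_bracket U x c \<in> \<Psi> ` torus}"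
      using sub br0 \<open>0 \<in> \<Psi> ` torus\<close> by auto
  qed
  thus ?thesis
    unfolding cartan_subalgebra_def using lie nil image_mono[OF sub] by blast
qed

lemma pairwise_bracket_generates:
  "pairwise_bracket_generates_split_g2 U (\<Psi> (zder 0 (vector [- 8, 0, 0]) 0))
     (\<Psi> (zder 0 (vector [0, 1/8, 0]) 0)) (\<Psi> (zder 0 (vector [0, 0, - 1]) 0))"
proof -
  define \<rho> :: 'a where "\<rho> = of_real (sqrt 3)"
  have \<rho>: "\<rho> \<noteq> 0" by (simp add: \<rho>_def)
  have tr: "trace (mat3 a b c d e f g h i) = a + e + i" for a b c d e f g h i :: 'a
    by (simp add: trace_def mat3_def sum_3)
  define D1 D2 D3 D4 D5 D6 H1 H2 E1 E2 E3 E4 E5 E6 :: "'a zorn \<Rightarrow> 'a zorn" where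
    "D1 = zder 0 (vector [- 8, 0, 0]) 0" and "D2 = zder 0 (vector [0, 1/8, 0]) 0"
    and "D3 = zder 0 (vector [0, 0, - 1]) 0" and "D4 = zder 0 0 (vector [0, 0, 2])"
    and "D5 = zder 0 0 (vector [1/4, 0, 0])" and "D6 = zder 0 0 (vector [0, - 16, 0])"
    and "H1 = zder (mat3 1 0 0 0 (- 1/2) 0 0 0 (- 1 - (- 1/2))) 0 0"
    and "H2 = zder (mat3 0 0 0 0 (\<rho>/2) 0 0 0 (- 0 - \<rho>/2)) 0 0"
    and "E1 = zder (mat3 0 0 48 0 0 0 0 0 0) 0 0" and "E2 = zder (mat3 0 0 0 0 0 (- 3/4) 0 0 0) 0 0"
    and "E3 = zder (mat3 0 0 0 (- 3/32) 0 0 0 0 0) 0 0" and "E4 = zder (mat3 0 0 0 0 0 0 (3/4) 0 0) 0 0"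
    and "E5 = zder (mat3 0 0 0 0 0 0 0 (- 48) 0) 0 0" and "E6 = zder (mat3 0 (- 384) 0 0 0 0 0 0 0) 0 0"
  note defs = D1_def D2_def D3_def D4_def D5_def D6_def H1_def H2_def E1_def E2_def E3_def E4_def E5_def E6_def
  have basis: "g2_basis \<rho> = [D1, D2, D3, D4, D5, D6, H1, H2, E1, E2, E3, E4, E5, E6]"
    by (simp add: g2_basis_def defs)
  have mems: "D \<in> split_g2" if "D \<in> {D1, D2, D3, D4, D5, D6, H1, H2, E1, E2, E3, E4, E5, E6}" for D
    using g2_basis_in_split_g2[of \<rho>] that unfolding basis by auto
  let ?A = "zder (mat3 2 0 0 0 2 0 0 0 (- 4)) 0 0 :: 'a zorn \<Rightarrow> 'a zorn"
  let ?B = "zder (mat3 (- 2) 0 0 0 4 0 0 0 (- 2)) 0 0 :: 'a zorn \<Rightarrow> 'a zorn"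
  have AB: "?A \<in> split_g2" "?B \<in> split_g2" by (auto intro!: zder_in_split_g2 simp: tr)
  have H: "H1 = zorn_op_scale (1/4) (?A - ?B)" "H2 = zorn_op_scale (\<rho>/12) (?A + ?B)"
    unfolding H1_def H2_def by (rule g2_cartan_elements)+
  have sub: "?A - ?B \<in> split_g2"
    using split_g2_closed(1)[OF AB(1) split_g2_scale[OF AB(2), of "- 1"]] by simp
  have comm: "commutator D1 D2 = D4" "commutator D2 D3 = D5" "commutator D3 D1 = D6"
    "commutator D1 D4 = E1" "commutator D2 D4 = E2" "commutator D2 D5 = E3"
    "commutator D3 D5 = E4" "commutator D3 D6 = E5" "commutator D1 D6 = E6"
    "commutator D2 D6 = ?B" "commutator D4 D3 = ?A"
    unfolding defs by (rule g2_commutators)+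
  have br: "field_bracket U (\<Psi> D) (\<Psi> D') = \<Psi> (commutator D D')"
    if "D \<in> {D1, D2, D3, D4, D5, D6, H1, H2, E1, E2, E3, E4, E5, E6}"
       "D' \<in> {D1, D2, D3, D4, D5, D6, H1, H2, E1, E2, E3, E4, E5, E6}" for D D'
    by (rule bracket[OF mems[OF that(1)] mems[OF that(2)]])
  have h: "field_scale (1/4) (\<Psi> ?A - \<Psi> ?B) = \<Psi> H1" "field_scale (\<rho>/12) (\<Psi> ?A + \<Psi> ?B) = \<Psi> H2"
    unfolding H using AB sub by (simp_all add: scale diff add split_g2_closed)
  have root: "root_vector field_scale (field_bracket U) (\<Psi> H1) (\<Psi> H2) (\<Psi> D) (c, d)"
    if D: "D \<in> {D1, D2, D3, D4, D5, D6, E1, E2, E3, E4, E5, E6}"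
      and "commutator H1 D = zorn_op_scale c D" "commutator H2 D = zorn_op_scale d D" for D c d
  proof -
    \<comment> \<open>Root vectors are nonzero because they belong to an independent set.\<close>
    have "\<Psi> D \<in> set (map \<Psi> (g2_basis \<rho>))" using D unfolding basis by auto
    hence "\<Psi> D \<noteq> 0"
      using independent_image_basis(2)[OF \<rho>] VF.dependent_zero by metis
    moreover have "D \<in> {D1, D2, D3, D4, D5, D6, H1, H2, E1, E2, E3, E4, E5, E6}" using D by auto
    ultimately show ?thesis
      using that(2,3) br[of H1 D] br[of H2 D] mems[of D]
      by (simp add: root_vector_def scale)
  qed
  have roots:
    "commutator H1 D1 = zorn_op_scale 1 D1" "commutator H2 D1 = zorn_op_scale 0 D1"
    "commutator H1 D5 = zorn_op_scale (- 1) D5" "commutator H2 D5 = zorn_op_scale 0 D5"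
    "commutator H1 D4 = zorn_op_scale (1/2) D4" "commutator H2 D4 = zorn_op_scale (\<rho>/2) D4"
    "commutator H1 D3 = zorn_op_scale (- 1/2) D3" "commutator H2 D3 = zorn_op_scale (- \<rho>/2) D3"
    "commutator H1 D2 = zorn_op_scale (- 1/2) D2" "commutator H2 D2 = zorn_op_scale (\<rho>/2) D2"
    "commutator H1 D6 = zorn_op_scale (1/2) D6" "commutator H2 D6 = zorn_op_scale (- \<rho>/2) D6"
    "commutator H1 E2 = zorn_op_scale 0 E2" "commutator H2 E2 = zorn_op_scale \<rho> E2"
    "commutator H1 E5 = zorn_op_scale 0 E5" "commutator H2 E5 = zorn_op_scale (- \<rho>) E5"
    "commutator H1 E1 = zorn_op_scale (3/2) E1" "commutator H2 E1 = zorn_op_scale (\<rho>/2) E1"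
    "commutator H1 E4 = zorn_op_scale (- 3/2) E4" "commutator H2 E4 = zorn_op_scale (- \<rho>/2) E4"
    "commutator H1 E3 = zorn_op_scale (- 3/2) E3" "commutator H2 E3 = zorn_op_scale (\<rho>/2) E3"
    "commutator H1 E6 = zorn_op_scale (3/2) E6" "commutator H2 E6 = zorn_op_scale (- \<rho>/2) E6"
    unfolding defs by (simp_all only: commutator_diagonal trace_zero tr add_0 add_0_right zorn_op_scale_zder)
      (simp_all add: zder_eq_iff vec_eq_iff forall_3 mat3_def)
  have span_h: "VF.span {\<Psi> H1, \<Psi> H2} = \<Psi> ` torus"
  proof
    have "zder (mat3 a 0 0 0 b 0 0 0 (- a - b)) 0 0 =
      zorn_op_scale a H1 + zorn_op_scale ((2 * b + a) / \<rho>) H2" for a b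
      unfolding H1_def H2_def zorn_op_scale_zder zder_add zder_eq_iff using \<rho>
      by (simp add: vec_eq_iff forall_3 mat3_def field_simps)
    moreover have "\<Psi> (zorn_op_scale a H1 + zorn_op_scale b H2) \<in> VF.span {\<Psi> H1, \<Psi> H2}" for a b
      using mems[of H1] mems[of H2]
      by (simp add: add scale split_g2_scale VF.span_add VF.span_scale VF.span_base)
    ultimately show "\<Psi> ` torus \<subseteq> VF.span {\<Psi> H1, \<Psi> H2}"
      by (auto simp: torus_def)
    have "VF.subspace (\<Psi> ` torus)"
      using cartan_torus by (simp add: cartan_subalgebra_def lie_algebra_def lie_algebra_axioms_def)
    moreover have "H1 \<in> torus" "H2 \<in> torus"
      unfolding torus_def H1_def H2_def by blast+
    ultimately show "VF.span {\<Psi> H1, \<Psi> H2} \<subseteq> \<Psi> ` torus"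
      by (intro VF.span_minimal) auto
  qed
  have set_basis: "map \<Psi> (g2_basis \<rho>) =
    [\<Psi> D1, \<Psi> D2, \<Psi> D3, \<Psi> D4, \<Psi> D5, \<Psi> D6, \<Psi> H1, \<Psi> H2, \<Psi> E1, \<Psi> E2, \<Psi> E3, \<Psi> E4, \<Psi> E5, \<Psi> E6]"
    by (simp add: basis)
  note ind = independent_image_basis[OF \<rho>, unfolded set_basis]
    and span = span_image_basis[OF \<rho>, unfolded set_basis]
  have lie: "lie_algebra field_scale (\<Psi> ` split_g2) (field_bracket U)"
    by (rule lie_algebra_image) (auto simp: split_g2_closed split_g2_scale)
  have brs: "field_bracket U (\<Psi> D1) (\<Psi> D2) = \<Psi> D4" "field_bracket U (\<Psi> D2) (\<Psi> D3) = \<Psi> D5"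
    "field_bracket U (\<Psi> D3) (\<Psi> D1) = \<Psi> D6" "field_bracket U (\<Psi> D1) (\<Psi> D4) = \<Psi> E1"
    "field_bracket U (\<Psi> D2) (\<Psi> D4) = \<Psi> E2" "field_bracket U (\<Psi> D2) (\<Psi> D5) = \<Psi> E3"
    "field_bracket U (\<Psi> D3) (\<Psi> D5) = \<Psi> E4" "field_bracket U (\<Psi> D3) (\<Psi> D6) = \<Psi> E5"
    "field_bracket U (\<Psi> D1) (\<Psi> D6) = \<Psi> E6" "field_bracket U (\<Psi> D2) (\<Psi> D6) = \<Psi> ?B"
    "field_bracket U (\<Psi> D4) (\<Psi> D3) = \<Psi> ?A"
    by (simp_all add: br comm)
  show ?thesis
    unfolding pairwise_bracket_generates_split_g2_def Let_def \<rho>_def[symmetric] D1_def[symmetric] D2_def[symmetric] D3_def[symmetric]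
    unfolding brs h span span_h
    using ind lie isomorphic cartan_torus smooth[OF mems] roots
    by (intro conjI root) simp_all
qed

end

section \<open>Differential algebras of functions and their vector fields\<close>

lemma UNIV_5: "(UNIV :: 5 set) = {1, 2, 3, 4, 5}"
proof -
  have "card {1, 2, 3, 4, 5 :: 5} = CARD(5)" by simp
  thus ?thesis by (metis card_subset_eq finite subset_UNIV)
qed

lemma forall_5: "(\<forall>i::5. P i) \<longleftrightarrow> P 1 \<and> P 2 \<and> P 3 \<and> P 4 \<and> P 5"
  using UNIV_5 by (metis UNIV_I empty_iff insert_iff)

lemma bounded_linear_axis: "bounded_linear (axis k :: 'a::real_normed_vector \<Rightarrow> 'a^'n)"
proof (rule bounded_linear_intro[where K = 1])
  show "norm (axis k x) \<le> norm x * 1" for x :: 'a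
    using L2_set_le_sum[of UNIV "\<lambda>i. norm ((axis k x :: 'a^'n) $ i)"]
    by (simp add: norm_vec_def axis_def if_distrib cong: if_cong)
qed (auto simp: axis_def vec_eq_iff)

lemma has_derivative_vec_componentwise:
  fixes X :: "'b::real_normed_vector \<Rightarrow> 'a::real_normed_vector^'n"
  assumes "\<And>k. ((\<lambda>u. X u $ k) has_derivative D k) (at u)"
  shows "(X has_derivative (\<lambda>h. \<chi> k. D k h)) (at u)"
proof -
  have sum_axis: "(\<Sum>k\<in>UNIV. axis k (f k)) = (\<chi> k. f k)" for f :: "'n \<Rightarrow> 'a"
    by (simp add: vec_eq_iff axis_def)
  have "((\<lambda>u. \<Sum>k\<in>UNIV. axis k (X u $ k)) has_derivative (\<lambda>h. \<Sum>k\<in>UNIV. axis k (D k h))) (at u)"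
    by (intro has_derivative_sum bounded_linear.has_derivative[OF bounded_linear_axis] assms)
  thus ?thesis unfolding sum_axis by simp
qed

lemma partial_deriv_eq:
  "(f has_derivative D) (at u) \<Longrightarrow> partial_deriv i f u = D (axis i 1)"
  unfolding partial_deriv_def by (metis frechet_derivative_at)

lemma partial_deriv_component:
  fixes X :: "real^5 \<Rightarrow> 'a::real_normed_vector^'n"
  assumes "\<And>k. (\<lambda>u. X u $ k) differentiable (at u)"
  shows "X differentiable (at u)" "partial_deriv i X u $ k = partial_deriv i (\<lambda>u. X u $ k) u"
proof -
  have D: "(X has_derivative (\<lambda>h. \<chi> k. frechet_derivative (\<lambda>u. X u $ k) (at u) h)) (at u)"
    using assms by (intro has_derivative_vec_componentwise) (simp add: frechet_derivative_works)
  thus "X differentiable (at u)" by (rule differentiableI)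
  show "partial_deriv i X u $ k = partial_deriv i (\<lambda>u. X u $ k) u"
    unfolding partial_deriv_eq[OF D] by (simp add: partial_deriv_def)
qed

lemma partial_deriv_add:
  assumes "f differentiable (at u)" "g differentiable (at u)"
  shows "partial_deriv i (\<lambda>u. f u + g u) u = partial_deriv i f u + partial_deriv i g u"
  using partial_deriv_eq[OF has_derivative_add[OF assms[unfolded frechet_derivative_works]]]
  by (simp add: partial_deriv_def)

lemma partial_deriv_mult:
  fixes f g :: "real^5 \<Rightarrow> 'a::real_normed_algebra"
  assumes "f differentiable (at u)" "g differentiable (at u)"
  shows "partial_deriv i (\<lambda>u. f u * g u) u = f u * partial_deriv i g u + partial_deriv i f u * g u"
  using partial_deriv_eq[OF has_derivative_mult[OF assms[unfolded frechet_derivative_works]]]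
  by (simp add: partial_deriv_def)

lemma partial_deriv_const: "partial_deriv i (\<lambda>u. c) u = 0"
  using partial_deriv_eq[OF has_derivative_const] .

text \<open>Both sides are choices over the same predicate, so the equation also covers points where
  neither function is differentiable.\<close>

lemma partial_deriv_cong:
  assumes "open U" "u \<in> U" "\<forall>v\<in>U. f v = g v"
  shows "partial_deriv i f u = partial_deriv i g u"
proof -
  have *: "(g has_derivative D) (at u)" if "(f has_derivative D) (at u)" "\<forall>v\<in>U. f v = g v" for D f g
    using has_derivative_transform_within_open[OF that(1) assms(1,2)] that(2) by blast
  hence "(f has_derivative D) (at u) \<longleftrightarrow> (g has_derivative D) (at u)" for D
    using assms(3) by (metis (full_types))
  thus ?thesis by (simp add: partial_deriv_def frechet_derivative_def)
qed

text \<open>Membership is syntactic, so differentiability, closure under partial derivatives and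
  symmetry of second partials pass from the generators by induction. The rule \<open>cong\<close>
  makes it a condition on \<open>U\<close> alone, where the derivative formulas hold.\<close>

inductive_set alg :: "(real^5) set \<Rightarrow> (real^5 \<Rightarrow> 'a::real_normed_field) set \<Rightarrow> (real^5 \<Rightarrow> 'a) set"
  for U G where
  gen: "g \<in> G \<Longrightarrow> g \<in> alg U G"
| const: "(\<lambda>u. c) \<in> alg U G"
| add: "f \<in> alg U G \<Longrightarrow> g \<in> alg U G \<Longrightarrow> (\<lambda>u. f u + g u) \<in> alg U G"
| mult: "f \<in> alg U G \<Longrightarrow> g \<in> alg U G \<Longrightarrow> (\<lambda>u. f u * g u) \<in> alg U G"
| cong: "f \<in> alg U G \<Longrightarrow> \<forall>u\<in>U. f u = g u \<Longrightarrow> g \<in> alg U G"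

definition dir :: "(real^5 \<Rightarrow> 'a::real_normed_field^5) \<Rightarrow> (real^5 \<Rightarrow> 'a) \<Rightarrow> real^5 \<Rightarrow> 'a" where
  "dir X f u = (\<Sum>i\<in>UNIV. X u $ i * partial_deriv i f u)"

lemma alg_uminus: "f \<in> alg U G \<Longrightarrow> (\<lambda>u. - f u) \<in> alg U G"
  using alg.mult[OF alg.const[of "- 1"]] by force

lemma alg_diff: "f \<in> alg U G \<Longrightarrow> g \<in> alg U G \<Longrightarrow> (\<lambda>u. f u - g u) \<in> alg U G"
  using alg.add[OF _ alg_uminus] by force

lemma alg_power: "f \<in> alg U G \<Longrightarrow> (\<lambda>u. f u ^ n) \<in> alg U G"
  by (induction n) (auto intro: alg.const alg.mult)

lemma alg_sum: "(\<And>i. i \<in> S \<Longrightarrow> f i \<in> alg U G) \<Longrightarrow> (\<lambda>u. \<Sum>i\<in>S. f i u) \<in> alg U G"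
  by (induction S rule: infinite_finite_induct) (auto intro: alg.const alg.add)

lemmas alg_intros = alg.const alg.add alg.mult alg_uminus alg_diff alg_power alg_sum

text \<open>Symmetry of second partials is demanded of generators only, where it is checked by hand;
  the product rule carries it to the whole algebra.\<close>

locale differential_algebra =
  fixes U :: "(real^5) set" and G :: "(real^5 \<Rightarrow> 'a::real_normed_field) set"
  assumes open_U: "open U"
    and gen_diff: "g \<in> G \<Longrightarrow> u \<in> U \<Longrightarrow> g differentiable (at u)"
    and gen_partial: "g \<in> G \<Longrightarrow> partial_deriv i g \<in> alg U G"
    and gen_commute: "g \<in> G \<Longrightarrow> u \<in> U \<Longrightarrow>
      partial_deriv i (partial_deriv j g) u = partial_deriv j (partial_deriv i g) u"
begin

abbreviation "A \<equiv> alg U G"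

lemma A_props:
  assumes "f \<in> A"
  shows "(\<forall>u\<in>U. f differentiable (at u)) \<and> (\<forall>i. partial_deriv i f \<in> A)"
  using assms
proof induction
  case (gen g)
  thus ?case using gen_diff gen_partial by blast
next
  case (const c)
  thus ?case by (auto simp: partial_deriv_const[abs_def] intro: alg.const)
next
  case (add f g)
  have "partial_deriv i (\<lambda>u. f u + g u) \<in> A" for i
    by (rule alg.cong[OF alg.add[of "partial_deriv i f" _ _ "partial_deriv i g"]])
      (use add in \<open>simp_all add: partial_deriv_add\<close>)
  thus ?case using add by auto
next
  case (mult f g)
  have "partial_deriv i (\<lambda>u. f u * g u) \<in> A" for i
    by (rule alg.cong[of "\<lambda>u. f u * partial_deriv i g u + partial_deriv i f u * g u"])
      (use mult in \<open>simp_all add: partial_deriv_mult alg.add alg.mult\<close>)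
  thus ?case using mult by auto
next
  case (cong f g)
  have "g differentiable (at u)" if "u \<in> U" for u
    using cong that open_U has_derivative_transform_within_open unfolding differentiable_def by metis
  moreover have "partial_deriv i g \<in> A" for i
    by (rule alg.cong[of "partial_deriv i f"])
      (use cong partial_deriv_cong[OF open_U] in auto)
  ultimately show ?case by blast
qed

lemma A_differentiable: "f \<in> A \<Longrightarrow> u \<in> U \<Longrightarrow> f differentiable (at u)"
  and A_partial: "f \<in> A \<Longrightarrow> partial_deriv i f \<in> A"
  using A_props by blast+

lemmas pd_add = partial_deriv_add[OF A_differentiable A_differentiable]
lemmas pd_mult = partial_deriv_mult[OF A_differentiable A_differentiable]
lemmas pd_cong = partial_deriv_cong[OF open_U]

lemma A_commute:
  assumes "f \<in> A" "u \<in> U"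
  shows "partial_deriv i (partial_deriv j f) u = partial_deriv j (partial_deriv i f) u"
  using assms(1)
proof induction
  case (gen g)
  thus ?case using gen_commute assms(2) by blast
next
  case (const c)
  thus ?case by (simp add: partial_deriv_const[abs_def])
next
  case (add f g)
  have "partial_deriv i (partial_deriv j (\<lambda>u. f u + g u)) u =
    partial_deriv i (partial_deriv j f) u + partial_deriv i (partial_deriv j g) u" for i j
    using add assms(2)
    by (subst pd_cong[of u _ "\<lambda>u. partial_deriv j f u + partial_deriv j g u"])
      (auto simp: pd_add A_partial)
  thus ?case using add by simp
next
  case (mult f g)
  have "partial_deriv i (partial_deriv j (\<lambda>u. f u * g u)) u =
    f u * partial_deriv i (partial_deriv j g) u + partial_deriv i f u * partial_deriv j g u
    + (partial_deriv j f u * partial_deriv i g u + partial_deriv i (partial_deriv j f) u * g u)" for i j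
    using mult assms(2)
    by (subst pd_cong[of u _ "\<lambda>u. f u * partial_deriv j g u + partial_deriv j f u * g u"])
      (auto simp: pd_add pd_mult A_partial alg.mult)
  thus ?case using mult by (simp add: algebra_simps)
next
  case (cong f g)
  have "partial_deriv i (partial_deriv j g) u = partial_deriv i (partial_deriv j f) u" for i j
    using cong assms(2) by (intro pd_cong ballI) (auto intro!: pd_cong)
  thus ?case using cong by simp
qed

lemma dir_add: "f \<in> A \<Longrightarrow> g \<in> A \<Longrightarrow> u \<in> U \<Longrightarrow> dir X (\<lambda>u. f u + g u) u = dir X f u + dir X g u"
  by (simp add: dir_def pd_add sum.distrib algebra_simps)

lemma dir_mult:
  "f \<in> A \<Longrightarrow> g \<in> A \<Longrightarrow> u \<in> U \<Longrightarrow> dir X (\<lambda>u. f u * g u) u = dir X f u * g u + f u * dir X g u"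
  by (simp add: dir_def pd_mult sum.distrib[symmetric] sum_distrib_left sum_distrib_right)
    (simp add: algebra_simps)

lemma dir_const: "dir X (\<lambda>u. c) u = 0"
  by (simp add: dir_def partial_deriv_const)

lemma dir_cong: "u \<in> U \<Longrightarrow> \<forall>v\<in>U. f v = g v \<Longrightarrow> dir X f u = dir X g u"
  unfolding dir_def by (intro sum.cong refl arg_cong2[where f = times] pd_cong)

lemma dir_uminus: "f \<in> A \<Longrightarrow> u \<in> U \<Longrightarrow> dir X (\<lambda>u. - f u) u = - dir X f u"
  using dir_mult[OF alg.const[of "- 1"], of f u X] by (simp add: dir_const)

lemma dir_diff: "f \<in> A \<Longrightarrow> g \<in> A \<Longrightarrow> u \<in> U \<Longrightarrow> dir X (\<lambda>u. f u - g u) u = dir X f u - dir X g u"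
  using dir_add[OF _ alg_uminus, of f g u X] by (simp add: dir_uminus)

lemma dir_power:
  "f \<in> A \<Longrightarrow> u \<in> U \<Longrightarrow> dir X (\<lambda>u. f u ^ n) u = of_nat n * f u ^ (n - 1) * dir X f u"
proof (induction n)
  case (Suc n)
  have "dir X (\<lambda>u. f u ^ Suc n) u = dir X f u * f u ^ n + f u * dir X (\<lambda>u. f u ^ n) u"
    using Suc by (simp add: dir_mult alg_power)
  thus ?case using Suc by (cases n) (simp_all add: algebra_simps)
qed (simp add: dir_const)

lemma dir_sum:
  "(\<And>i. i \<in> S \<Longrightarrow> f i \<in> A) \<Longrightarrow> u \<in> U \<Longrightarrow> dir X (\<lambda>u. \<Sum>i\<in>S. f i u) u = (\<Sum>i\<in>S. dir X (f i) u)"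
  by (induction S rule: infinite_finite_induct) (auto simp: dir_const dir_add alg_sum)

lemmas dir_simps = dir_add dir_mult dir_const dir_uminus dir_diff dir_power dir_sum

section \<open>Vector fields with coefficients in the algebra, acting as derivations\<close>

definition fields :: "(real^5 \<Rightarrow> 'a^5) set" where
  "fields = {X. (\<forall>k. (\<lambda>u. X u $ k) \<in> A) \<and> (\<forall>u. u \<notin> U \<longrightarrow> X u = 0)}"

lemma fields_add: "X \<in> fields \<Longrightarrow> Y \<in> fields \<Longrightarrow> X + Y \<in> fields"
  by (auto simp: fields_def intro!: alg_intros)

lemma fields_scale: "X \<in> fields \<Longrightarrow> field_scale c X \<in> fields"
  by (auto simp: fields_def field_scale_def intro!: alg_intros)

lemma fields_zero: "0 \<in> fields"
  by (auto simp: fields_def intro!: alg_intros)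

lemma dir_in_A: "X \<in> fields \<Longrightarrow> f \<in> A \<Longrightarrow> dir X f \<in> A"
  unfolding dir_def[abs_def] by (auto simp: fields_def intro!: alg_intros A_partial)

lemma dir_field_add: "dir (X + Y) f u = dir X f u + dir Y f u"
  by (simp add: dir_def sum.distrib algebra_simps)

lemma dir_field_scale: "dir (field_scale c X) f u = c * dir X f u"
  by (simp add: dir_def field_scale_def sum_distrib_left algebra_simps)

lemma fields_component:
  assumes "X \<in> fields" "u \<in> U"
  shows "X differentiable (at u)" "partial_deriv i X u $ k = partial_deriv i (\<lambda>u. X u $ k) u"
  using partial_deriv_component[of X u] A_differentiable assms by (auto simp: fields_def)

lemma fields_smooth:
  assumes "X \<in> fields"
  shows "X \<in> vector_fields U"
proof -
  have "smooth_on U X" if "\<forall>k. (\<lambda>u. X u $ k) \<in> A" for X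
    using that
  \<comment> \<open>The invariant asks only for components in \<open>A\<close>. Vanishing outside
    \<open>U\<close> is left out of it, since the chosen derivatives need not vanish there.\<close>
  proof (coinduction arbitrary: X)
    case smooth_on
    have diff: "(\<lambda>u. X u $ k) differentiable (at u)" if "u \<in> U" for u k
      using smooth_on that A_differentiable by blast
    have "(\<lambda>u. frechet_derivative X (at u) (axis i 1) $ k) \<in> A" for i k
      by (rule alg.cong[OF A_partial[of "\<lambda>u. X u $ k" i]])
        (use smooth_on partial_deriv_component(2)[OF diff] in \<open>auto simp: partial_deriv_def\<close>)
    thus ?case
      using partial_deriv_component(1)[OF diff] by (auto simp: Basis_vec_def)
  qed
  thus ?thesis using assms by (auto simp: vector_fields_def fields_def)
qed

lemma field_bracket_component:
  assumes "X \<in> fields" "Y \<in> fields" "u \<in> U"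
  shows "field_bracket U X Y u $ k = dir X (\<lambda>u. Y u $ k) u - dir Y (\<lambda>u. X u $ k) u"
  using assms by (simp add: field_bracket_def restrict_field_def dir_def fields_component sum_subtractf)

lemma fields_bracket:
  assumes "X \<in> fields" "Y \<in> fields"
  shows "field_bracket U X Y \<in> fields"
proof -
  have "(\<lambda>u. field_bracket U X Y u $ k) \<in> A" for k
    by (rule alg.cong[OF alg_diff[of "dir X (\<lambda>u. Y u $ k)" _ _ "dir Y (\<lambda>u. X u $ k)"]])
      (use assms field_bracket_component in \<open>auto intro!: dir_in_A simp: fields_def\<close>)
  thus ?thesis by (simp add: fields_def field_bracket_def restrict_field_def)
qed

text \<open>The second-order terms of the two compositions agree by \<open>A_commute\<close>; what
  survives are the derivatives of the coefficients.\<close>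

lemma dir_bracket:
  assumes "X \<in> fields" "Y \<in> fields" "f \<in> A" "u \<in> U"
  shows "dir (field_bracket U X Y) f u = dir X (dir Y f) u - dir Y (dir X f) u"
proof -
  have *: "dir X (dir Y f) u = (\<Sum>i\<in>UNIV. dir X (\<lambda>u. Y u $ i) u * partial_deriv i f u)
      + (\<Sum>i\<in>UNIV. \<Sum>j\<in>UNIV. Y u $ i * (X u $ j * partial_deriv j (partial_deriv i f) u))"
    if "X \<in> fields" "Y \<in> fields" for X Y
  proof -
    have "(\<lambda>u. Y u $ i) \<in> A" for i using that by (simp add: fields_def)
    hence "dir X (dir Y f) u =
      (\<Sum>i\<in>UNIV. dir X (\<lambda>u. Y u $ i) u * partial_deriv i f u + Y u $ i * dir X (partial_deriv i f) u)"
      unfolding dir_def[of Y f, abs_def]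
      using assms by (simp add: dir_sum dir_mult alg.mult A_partial)
    thus ?thesis by (simp add: sum.distrib dir_def[of X "partial_deriv _ f"] sum_distrib_left)
  qed
  have "(\<Sum>i\<in>UNIV. \<Sum>j\<in>UNIV. Y u $ i * (X u $ j * partial_deriv j (partial_deriv i f) u)) =
    (\<Sum>i\<in>UNIV. \<Sum>j\<in>UNIV. X u $ i * (Y u $ j * partial_deriv j (partial_deriv i f) u))"
    by (subst sum.swap) (simp add: A_commute[OF assms(3,4)] mult.left_commute)
  thus ?thesis
    unfolding *[OF assms(1,2)] *[OF assms(2,1)]
    by (simp add: dir_def[of "field_bracket U X Y"] field_bracket_component assms sum_subtractf
        left_diff_distrib)
qed

end

section \<open>Lifting derivations to vector fields\<close>

definition zcoord :: "nat \<Rightarrow> 'a zorn \<Rightarrow> 'a" where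
  "zcoord k = (\<lambda>(a, u, v, b). [a, u$1, u$2, u$3, v$1, v$2, v$3, b] ! k)"

definition zunit :: "nat \<Rightarrow> 'a::comm_ring_1 zorn" where
  "zunit k = [(1, 0, 0, 0), (0, axis 1 1, 0, 0), (0, axis 2 1, 0, 0), (0, axis 3 1, 0, 0),
     (0, 0, axis 1 1, 0), (0, 0, axis 2 1, 0), (0, 0, axis 3 1, 0), (0, 0, 0, 1)] ! k"

lemma all_less_8: "(\<forall>k<8::nat. P k) \<longleftrightarrow> P 0 \<and> P 1 \<and> P 2 \<and> P 3 \<and> P 4 \<and> P 5 \<and> P 6 \<and> P 7"
  by (auto simp: All_less_Suc eval_nat_numeral)

lemma sum_less_8:
  "(\<Sum>k<8::nat. f k) = f 0 + f 1 + f 2 + f 3 + f 4 + f 5 + f 6 + f 7"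
  by (simp add: eval_nat_numeral)

lemma zcoord_linear:
  assumes "k < 8"
  shows "zcoord k (x + y) = zcoord k x + zcoord k (y :: 'a::comm_ring_1 zorn)"
    "zcoord k (x - y) = zcoord k x - zcoord k y"
    "zcoord k (zorn_scale c x) = c * zcoord k x"
proof -
  have "\<forall>k<8. zcoord k (x + y) = zcoord k x + zcoord k y \<and>
    zcoord k (x - y) = zcoord k x - zcoord k y \<and> zcoord k (zorn_scale c x) = c * zcoord k x"
    unfolding all_less_8 by (cases x; cases y) (simp add: zcoord_def)
  thus "zcoord k (x + y) = zcoord k x + zcoord k y" "zcoord k (x - y) = zcoord k x - zcoord k y"
    "zcoord k (zorn_scale c x) = c * zcoord k x"
    using assms by blast+
qed

lemma zorn_op_scale_minus_one: "zorn_op_scale (- 1) D = - (D :: 'a::field zorn \<Rightarrow> 'a zorn)"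
proof -
  interpret vector_space "zorn_op_scale :: 'a \<Rightarrow> _" by (rule vector_space_zorn_op_scale)
  show ?thesis by simp
qed

lemma zorn_expansion: "w = (\<Sum>k<8. zorn_scale (zcoord k w) (zunit k :: 'a::comm_ring_1 zorn))"
  unfolding sum_less_8 by (cases w) (simp add: zcoord_def zunit_def vec_eq_iff forall_3 axis_def)

text \<open>The matrix of \<open>D\<close> in the units is constant, which lets directional
  derivatives pass through \<open>D\<close>.\<close>

lemma zcoord_split_g2:
  assumes D: "D \<in> (split_g2 :: ('a::field zorn \<Rightarrow> 'a zorn) set)" and "j < 8"
  shows "zcoord j (D w) = (\<Sum>k<8. zcoord j (D (zunit k)) * zcoord k w)"
proof -
  have "D w = D (\<Sum>k<8. zorn_scale (zcoord k w) (zunit k))" using zorn_expansion[of w] by simp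
  thus ?thesis
    unfolding sum_less_8 split_g2_derivation(1,2)[OF D] using \<open>j < 8\<close>
    by (simp add: zcoord_linear mult.commute)
qed

text \<open>\<open>w\<close> is a section of the cone of null imaginary octonions, normalised by its coordinate
  number 3. The derivation algebra acts on the projectivised cone, and \<open>lifts X D\<close> says that \<open>X\<close>
  is the vector field of that action in the coordinates \<open>w\<close>. The sign in \<open>- D\<close> makes this
  correspondence a homomorphism rather than an antihomomorphism.\<close>

locale octonion_section = differential_algebra U G
  for U and G :: "(real^5 \<Rightarrow> 'a::real_normed_field) set" +
  fixes w :: "real^5 \<Rightarrow> 'a zorn"
  assumes w_A: "k < 8 \<Longrightarrow> (\<lambda>u. zcoord k (w u)) \<in> alg U G"
    and w_normal: "zcoord 3 (w u) = 1"
    and immersion: "X \<in> differential_algebra.fields U G \<Longrightarrow>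
      (\<And>k u. k < 8 \<Longrightarrow> u \<in> U \<Longrightarrow> dir X (\<lambda>u. zcoord k (w u)) u = 0) \<Longrightarrow> X = 0"
begin

definition lifts :: "(real^5 \<Rightarrow> 'a^5) \<Rightarrow> ('a zorn \<Rightarrow> 'a zorn) \<Rightarrow> bool" where
  "lifts X D \<longleftrightarrow> X \<in> fields \<and> (\<exists>l\<in>A. \<forall>u\<in>U. \<forall>k<8.
     dir X (\<lambda>u. zcoord k (w u)) u = zcoord k (zorn_scale (l u) (w u) - D (w u)))"

lemma lifts_add: "lifts X D \<Longrightarrow> lifts Y E \<Longrightarrow> lifts (X + Y) (D + E)"
proof -
  assume "lifts X D" "lifts Y E"
  then obtain l m where "X \<in> fields" "Y \<in> fields" "l \<in> A" "m \<in> A"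
    and "\<And>u k. u \<in> U \<Longrightarrow> k < 8 \<Longrightarrow> dir X (\<lambda>u. zcoord k (w u)) u = zcoord k (zorn_scale (l u) (w u) - D (w u))"
    and "\<And>u k. u \<in> U \<Longrightarrow> k < 8 \<Longrightarrow> dir Y (\<lambda>u. zcoord k (w u)) u = zcoord k (zorn_scale (m u) (w u) - E (w u))"
    unfolding lifts_def by blast
  thus ?thesis
    unfolding lifts_def
    by (auto simp: fields_add dir_field_add zcoord_linear algebra_simps intro!: bexI[of _ "\<lambda>u. l u + m u"] alg.add)
qed

lemma lifts_scale: "lifts X D \<Longrightarrow> lifts (field_scale c X) (zorn_op_scale c D)"
proof -
  assume "lifts X D"
  then obtain l where "X \<in> fields" "l \<in> A"
    and "\<And>u k. u \<in> U \<Longrightarrow> k < 8 \<Longrightarrow> dir X (\<lambda>u. zcoord k (w u)) u = zcoord k (zorn_scale (l u) (w u) - D (w u))"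
    unfolding lifts_def by blast
  thus ?thesis
    unfolding lifts_def
    by (auto simp: fields_scale dir_field_scale zorn_op_scale_def zcoord_linear right_diff_distrib mult.assoc
        intro!: bexI[of _ "\<lambda>u. c * l u"] alg.mult alg.const)
qed

lemma dir_split_g2:
  assumes "D \<in> split_g2" "u \<in> U" "j < 8"
    and "\<And>k. k < 8 \<Longrightarrow> dir X (\<lambda>u. zcoord k (w u)) u = zcoord k z"
  shows "dir X (\<lambda>u. zcoord j (D (w u))) u = zcoord j (D z)" "(\<lambda>u. zcoord j (D (w u))) \<in> A"
proof -
  have expand: "(\<lambda>u. zcoord j (D (w u))) = (\<lambda>u. \<Sum>k<8. zcoord j (D (zunit k)) * zcoord k (w u))"
    by (rule ext) (rule zcoord_split_g2[OF assms(1,3)])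
  have A: "(\<lambda>u. zcoord j (D (zunit k)) * zcoord k (w u)) \<in> A" if "k \<in> {..<8}" for k
    using that by (intro alg.mult alg.const w_A) simp
  show "(\<lambda>u. zcoord j (D (w u))) \<in> A"
    unfolding expand by (rule alg_sum[OF A])
  have "dir X (\<lambda>u. zcoord j (D (zunit k)) * zcoord k (w u)) u = zcoord j (D (zunit k)) * zcoord k z"
    if "k < 8" for k
    using assms(2,4) that by (simp add: dir_mult alg.const w_A dir_const)
  thus "dir X (\<lambda>u. zcoord j (D (w u))) u = zcoord j (D z)"
    unfolding expand zcoord_split_g2[OF assms(1,3), of z] by (subst dir_sum[OF A assms(2)]) simp_all
qed

text \<open>In X(Y(w)) - Y(X(w)) the terms m D w and l E w cancel, leaving - (D E - E D) w and the
  new multiplier X(m) - Y(l). This is why multipliers must lie in \<open>A\<close>.\<close>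

lemma lifts_bracket:
  assumes "lifts X D" "lifts Y E" "D \<in> split_g2" "E \<in> split_g2"
  shows "lifts (field_bracket U X Y) (commutator D E)"
proof -
  obtain l m where X: "X \<in> fields" "l \<in> A"
      "\<And>u k. u \<in> U \<Longrightarrow> k < 8 \<Longrightarrow> dir X (\<lambda>u. zcoord k (w u)) u = zcoord k (zorn_scale (l u) (w u) - D (w u))"
    and Y: "Y \<in> fields" "m \<in> A"
      "\<And>u k. u \<in> U \<Longrightarrow> k < 8 \<Longrightarrow> dir Y (\<lambda>u. zcoord k (w u)) u = zcoord k (zorn_scale (m u) (w u) - E (w u))"
    using assms unfolding lifts_def by blast
  have iter: "dir X (dir Y (\<lambda>u. zcoord k (w u))) u =
      dir X m u * zcoord k (w u) + m u * (l u * zcoord k (w u) - zcoord k (D (w u)))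
      - (l u * zcoord k (E (w u)) - zcoord k (E (D (w u))))"
    if "X \<in> fields" "l \<in> A"
      "\<And>u k. u \<in> U \<Longrightarrow> k < 8 \<Longrightarrow> dir X (\<lambda>u. zcoord k (w u)) u = zcoord k (zorn_scale (l u) (w u) - D (w u))"
      "Y \<in> fields" "m \<in> A"
      "\<And>u k. u \<in> U \<Longrightarrow> k < 8 \<Longrightarrow> dir Y (\<lambda>u. zcoord k (w u)) u = zcoord k (zorn_scale (m u) (w u) - E (w u))"
      "E \<in> split_g2" "u \<in> U" "k < 8"
    for X Y l m D E u k
  proof -
    note E = dir_split_g2[OF that(7,8,9) that(3)[OF that(8)]]
    have minus: "E (x - y) = E x - E y" for x y
      using split_g2_derivation(1)[OF that(7), of "x - y" y] by simp
    have "dir X (dir Y (\<lambda>u. zcoord k (w u))) u = dir X (\<lambda>u. m u * zcoord k (w u) - zcoord k (E (w u))) u"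
      using that by (intro dir_cong) (auto simp: zcoord_linear)
    also have "\<dots> = dir X m u * zcoord k (w u) + m u * dir X (\<lambda>u. zcoord k (w u)) u
        - zcoord k (E (zorn_scale (l u) (w u) - D (w u)))"
      using that E w_A by (simp add: dir_diff dir_mult alg.mult)
    finally show ?thesis
      using that by (simp add: zcoord_linear minus split_g2_derivation(2))
  qed
  have "dir (field_bracket U X Y) (\<lambda>u. zcoord k (w u)) u =
      zcoord k (zorn_scale (dir X m u - dir Y l u) (w u) - commutator D E (w u))"
    if "u \<in> U" "k < 8" for u k
  proof -
    have XY: "dir X (dir Y (\<lambda>u. zcoord k (w u))) u =
      dir X m u * zcoord k (w u) + m u * (l u * zcoord k (w u) - zcoord k (D (w u)))
      - (l u * zcoord k (E (w u)) - zcoord k (E (D (w u))))"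
      by (rule iter) (fact X Y assms that)+
    have YX: "dir Y (dir X (\<lambda>u. zcoord k (w u))) u =
      dir Y l u * zcoord k (w u) + l u * (m u * zcoord k (w u) - zcoord k (E (w u)))
      - (m u * zcoord k (D (w u)) - zcoord k (D (E (w u))))"
      by (rule iter) (fact X Y assms that)+
    show ?thesis
      unfolding dir_bracket[OF X(1) Y(1) w_A[OF that(2)] that(1)] XY YX
      using that(2) by (simp add: zcoord_linear commutator_def algebra_simps)
  qed
  thus ?thesis
    unfolding lifts_def using X Y
    by (auto simp: fields_bracket intro!: bexI[of _ "\<lambda>u. dir X m u - dir Y l u"] alg_diff dir_in_A)
qed

lemma lifts_unique:
  assumes "lifts X D" "lifts Y D" "D \<in> split_g2"
  shows "X = Y"
proof -
  have "lifts (X + field_scale (- 1) Y) (D + zorn_op_scale (- 1) D)"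
    using assms by (intro lifts_add lifts_scale)
  moreover have "D + zorn_op_scale (- 1) D = 0"
    by (simp add: zorn_op_scale_minus_one)
  moreover have "X + field_scale (- 1) Y = X - Y"
    by (auto simp: fun_eq_iff field_scale_def vec_eq_iff)
  ultimately obtain l where "X - Y \<in> fields" and l: "\<And>u k. u \<in> U \<Longrightarrow> k < 8 \<Longrightarrow>
      dir (X - Y) (\<lambda>u. zcoord k (w u)) u = l u * zcoord k (w u)"
    by (auto simp: lifts_def zcoord_linear)
  \<comment> \<open>Coordinate 3 of \<open>w\<close> is constantly 1, so its derivative 0 equals the
    multiplier.\<close>
  moreover have "l u = 0" if "u \<in> U" for u
    using l[OF that, of 3] by (simp add: w_normal dir_const)
  ultimately have "X - Y = 0" by (intro immersion) auto
  thus ?thesis by simp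
qed

text \<open>Liftable derivations form a subalgebra containing the generators, hence everything. The
  derivations that lift to 0 form an ideal, so simplicity reduces injectivity to \<open>S2\<close>
  being nonzero.\<close>

theorem generates:
  assumes S: "lifts S1 (zder 0 (vector [- 8, 0, 0]) 0)" "lifts S2 (zder 0 (vector [0, 1/8, 0]) 0)"
    "lifts S3 (zder 0 (vector [0, 0, - 1]) 0)" and "S2 \<noteq> 0"
  shows "pairwise_bracket_generates_split_g2 U S1 S2 S3"
proof -
  have zder0: "zder 0 r s \<in> split_g2" for r s :: "'a^3"
    by (simp add: zder_in_split_g2)
  have "split_g2 \<subseteq> {D \<in> split_g2. \<exists>X. lifts X D}"
    by (rule split_g2_generated)
      (use S zder0 in \<open>blast intro: split_g2_closed split_g2_scale lifts_add lifts_scale lifts_bracket\<close>)+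
  hence ex: "\<exists>X. lifts X D" if "D \<in> split_g2" for D using that by blast
  define \<Psi> where "\<Psi> D = (THE X. lifts X D)" for D
  have \<Psi>_eq: "\<Psi> D = X" if "lifts X D" "D \<in> split_g2" for X D
    unfolding \<Psi>_def using that lifts_unique by (intro the_equality) auto
  have \<Psi>: "lifts (\<Psi> D) D" if "D \<in> split_g2" for D
    using ex[OF that] \<Psi>_eq[OF _ that] by auto
  let ?N = "{D \<in> split_g2. lifts 0 D}"
  have kernel: "D = zder 0 0 0" if "D \<in> ?N" for D
  proof (rule ccontr)
    assume "D \<noteq> zder 0 0 0"
    have br0: "field_bracket U X 0 = 0" if "X \<in> fields" for X
    proof
      fix u
      have "field_bracket U X 0 u $ k = 0" if "u \<in> U" for k
        using field_bracket_component[OF \<open>X \<in> fields\<close> fields_zero that, of k]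
        by (simp add: dir_const dir_def[of 0])
      thus "field_bracket U X 0 u = 0 u"
        by (cases "u \<in> U") (auto simp: vec_eq_iff field_bracket_def[of U X 0] restrict_field_def)
    qed
    \<comment> \<open>This is 8 times the derivation lifted by \<open>S2\<close>; were it in the
      kernel, uniqueness of lifts would give \<open>S2 = 0\<close>.\<close>
    have "zder 0 (axis 2 1) 0 \<in> ?N"
    proof (rule split_g2_ideal[OF _ _ _ that \<open>D \<noteq> zder 0 0 0\<close>])
      show "zorn_op_scale c D \<in> ?N" if "D \<in> ?N" for c D
        using that lifts_scale[of 0 D c] split_g2_scale by (auto simp: field_scale_def zero_fun_def)
      show "commutator X D \<in> ?N" if "X \<in> split_g2" "D \<in> ?N" for X D
        using that lifts_bracket[OF \<Psi> _ that(1), of 0 D] \<Psi>[OF that(1)] br0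
        by (auto simp: split_g2_closed lifts_def)
    qed simp
    hence "lifts (field_scale (1/8) 0) (zorn_op_scale (1/8) (zder 0 (axis 2 1) 0))"
      using lifts_scale by simp
    moreover have "zorn_op_scale (1/8) (zder 0 (axis 2 1) 0) = zder 0 (vector [0, 1/8, 0]) (0::'a^3)"
      unfolding zorn_op_scale_zder zder_eq_iff by (simp add: vec_eq_iff forall_3 axis_def)
    ultimately have "S2 = field_scale (1/8) 0"
      using S(2) zder0 lifts_unique by metis
    thus False using \<open>S2 \<noteq> 0\<close> by (simp add: field_scale_def zero_fun_def)
  qed
  interpret split_g2_embedding U \<Psi>
  proof
    fix D E :: "'a zorn \<Rightarrow> 'a zorn" and c
    assume D: "D \<in> split_g2"
    show "\<Psi> (zorn_op_scale c D) = field_scale c (\<Psi> D)"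
      using D by (intro \<Psi>_eq lifts_scale \<Psi> split_g2_scale)
    show "\<Psi> D \<in> vector_fields U"
      using \<Psi>[OF D] fields_smooth by (simp add: lifts_def)
    assume E: "E \<in> split_g2"
    show "\<Psi> (D + E) = \<Psi> D + \<Psi> E"
      using D E by (intro \<Psi>_eq lifts_add \<Psi> split_g2_closed)
    show "field_bracket U (\<Psi> D) (\<Psi> E) = \<Psi> (commutator D E)"
      using D E by (intro \<Psi>_eq[symmetric] lifts_bracket \<Psi> split_g2_closed)
  next
    show "inj_on \<Psi> split_g2"
    proof (rule inj_onI)
      fix D E :: "'a zorn \<Rightarrow> 'a zorn"
      assume *: "D \<in> split_g2" "E \<in> split_g2" "\<Psi> D = \<Psi> E"
      have "lifts (\<Psi> D + field_scale (- 1) (\<Psi> E)) (D + zorn_op_scale (- 1) E)"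
        using * by (intro lifts_add lifts_scale \<Psi>)
      moreover have "\<Psi> D + field_scale (- 1) (\<Psi> E) = 0"
        by (simp add: *(3) fun_eq_iff field_scale_def)
      ultimately have "D + zorn_op_scale (- 1) E = zder 0 0 0"
        using * by (intro kernel) (simp add: split_g2_closed split_g2_scale)
      moreover have "zder 0 0 0 = (0 :: 'a zorn \<Rightarrow> 'a zorn)"
        by (rule ext) (auto simp: zorn_component_simps zero_prod_def)
      ultimately show "D = E" by (simp add: zorn_op_scale_minus_one)
    qed
  qed
  show ?thesis
    using pairwise_bracket_generates S zder0 by (simp add: \<Psi>_eq)
qed

end

section \<open>Functions and fields built from a Chazy solution\<close>

lemma has_vector_derivative_exp:
  fixes f :: "real \<Rightarrow> 'a::{real_normed_field,banach}"
  assumes "(f has_vector_derivative f') (at x)"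
  shows "((\<lambda>x. exp (f x)) has_vector_derivative f' * exp (f x)) (at x)"
  using field_vector_diff_chain_at[OF assms DERIV_exp] by (simp add: o_def)

lemma has_vector_derivative_inverse:
  fixes f :: "real \<Rightarrow> 'a::real_normed_field"
  assumes "(f has_vector_derivative f') (at x)" "f x \<noteq> 0"
  shows "((\<lambda>x. 1 / f x) has_vector_derivative - f' / (f x)^2) (at x)"
  using field_vector_diff_chain_at[OF assms(1) DERIV_inverse[OF assms(2)]]
  by (simp add: o_def inverse_eq_divide power2_eq_square)

lemma has_derivative_x:
  "(\<phi> has_vector_derivative d) (at (u $ 1)) \<Longrightarrow>
    ((\<lambda>u::real^5. \<phi> (u $ 1)) has_derivative (\<lambda>h. h $ 1 *\<^sub>R d)) (at u)"
  using diff_chain_at[OF bounded_linear_imp_has_derivative[OF bounded_linear_vec_nth[of 1]]]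
  by (force simp: o_def has_vector_derivative_def)

lemma partial_deriv_x:
  assumes "(\<phi> has_vector_derivative d) (at (u $ 1))"
  shows "partial_deriv i (\<lambda>u. \<phi> (u $ 1)) u = (if i = 1 then d else 0)"
  using partial_deriv_eq[OF has_derivative_x[OF assms]] by (simp add: axis_def)

lemma has_derivative_coordinate:
  "((\<lambda>u. of_real (u $ i) :: 'a::real_normed_algebra_1) has_derivative (\<lambda>h. of_real (h $ i))) (at (u::real^5))"
  by (intro bounded_linear_imp_has_derivative bounded_linear_compose[OF bounded_linear_of_real bounded_linear_vec_nth])

lemma partial_deriv_coordinate:
  "partial_deriv i (\<lambda>u. of_real (u $ j) :: 'a::real_normed_algebra_1) = (\<lambda>u. of_real (axis i 1 $ j))"
  by (rule ext) (rule partial_deriv_eq[OF has_derivative_coordinate])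

lemma differential_algebra_of_x:
  fixes \<Phi> :: "(real \<Rightarrow> 'a::real_normed_field) set"
  defines "G \<equiv> range (\<lambda>i u. of_real (u $ i)) \<union> (\<lambda>\<phi> u. \<phi> (u $ 1)) ` \<Phi>"
  assumes "open U"
    and \<Phi>: "\<And>\<phi>. \<phi> \<in> \<Phi> \<Longrightarrow> \<exists>\<psi>. (\<lambda>u. \<psi> (u $ 1)) \<in> alg U G \<and>
      (\<forall>u\<in>U. (\<phi> has_vector_derivative \<psi> (u $ 1)) (at (u $ 1)) \<and> \<psi> differentiable (at (u $ 1)))"
  shows "differential_algebra U G"
proof
    fix g and u :: "real^5" and i j assume "g \<in> G"
    then consider (coord) k where "g = (\<lambda>u. of_real (u $ k))" | (x) \<phi> where "\<phi> \<in> \<Phi>" "g = (\<lambda>u. \<phi> (u $ 1))"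
      by (auto simp: G_def)
    note cases = this
    from cases show "g differentiable (at u)" if "u \<in> U"
      by cases (use has_derivative_coordinate has_derivative_x \<Phi> that in \<open>metis differentiableI\<close>)+
    from cases show "partial_deriv i g \<in> alg U G"
    proof cases
      case coord
      thus ?thesis by (simp add: partial_deriv_coordinate alg.const)
    next
      case (x \<phi>)
      then obtain \<psi> where "(\<lambda>u. \<psi> (u $ 1)) \<in> alg U G" "\<forall>u\<in>U. (\<phi> has_vector_derivative \<psi> (u $ 1)) (at (u $ 1))"
        using \<Phi> by metis
      moreover from this have "(\<lambda>u. if i = 1 then \<psi> (u $ 1) else 0) \<in> alg U G"
        by (cases "i = 1") (simp_all add: alg.const)
      moreover have "partial_deriv i g u = (if i = 1 then \<psi> (u $ 1) else 0)" if "u \<in> U" for u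
        unfolding x(2) using calculation that by (intro partial_deriv_x) simp
      ultimately show ?thesis
        by - (rule alg.cong[of "\<lambda>u. if i = 1 then \<psi> (u $ 1) else 0"], assumption, simp)
    qed
    from cases show "partial_deriv i (partial_deriv j g) u = partial_deriv j (partial_deriv i g) u" if "u \<in> U"
    proof cases
      case coord
      thus ?thesis by (simp add: partial_deriv_coordinate partial_deriv_const)
    next
      case (x \<phi>)
      then obtain \<psi> where \<psi>: "\<forall>u\<in>U. (\<phi> has_vector_derivative \<psi> (u $ 1)) (at (u $ 1)) \<and> \<psi> differentiable (at (u $ 1))"
        using \<Phi> by metis
      have pd: "partial_deriv j g v = (if j = 1 then \<psi> (v $ 1) else 0)" if "v \<in> U" for j v
        unfolding x(2) using \<psi> that by (intro partial_deriv_x) simp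
      \<comment> \<open>A function of x alone has only one second partial that can be nonzero, and
        that one is symmetric.\<close>
      have "partial_deriv i (partial_deriv j g) u = 0" if "i \<noteq> 1 \<or> j \<noteq> 1" for i j
      proof -
        have "partial_deriv i (partial_deriv j g) u = partial_deriv i (\<lambda>u. if j = 1 then \<psi> (u $ 1) else 0) u"
          by (intro partial_deriv_cong[OF \<open>open U\<close> \<open>u \<in> U\<close>]) (simp add: pd)
        also have "\<dots> = 0"
          using that \<psi> \<open>u \<in> U\<close> partial_deriv_x[of \<psi> _ u i]
          by (cases "j = 1") (auto simp: partial_deriv_const vector_derivative_works)
        finally show ?thesis .
      qed
      thus ?thesis by metis
    qed
  qed fact

section \<open>The Chazy system as a differential algebra\<close>

locale chazy_setting = chazy_fields P IP \<eta> chi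
  for P IP \<eta> chi :: "real \<Rightarrow> 'a::{real_normed_field,banach}" +
  fixes I :: "real set" and U :: "(real^5) set"
  assumes open_I: "open I"
    and chazy: "generalised_chazy (2/3) I P"
    and IP: "\<forall>x\<in>I. (IP has_vector_derivative P x) (at x)"
    and eta: "eta_equation I"
    and chi: "\<forall>x\<in>I. \<eta> x \<noteq> 0 \<longrightarrow> (chi has_vector_derivative 1 / (\<eta> x)^2) (at x)"
    and open_U: "open U" and U: "\<forall>u\<in>U. u$1 \<in> I \<and> \<eta> (u$1) \<noteq> 0"
begin

lemma chazy_system:
  assumes "x \<in> I"
  shows "(P has_vector_derivative 1/6 * ((P x)^2 - Q x)) (at x)"
    and "(Q has_vector_derivative 2/3 * (P x * Q x - R x)) (at x)"
    and "(R has_vector_derivative P x * R x + 1/80 * (Q x)^2) (at x)"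
proof -
  obtain P1 P2 P3 where P1: "\<And>x. x \<in> I \<Longrightarrow> (P has_vector_derivative P1 x) (at x)"
    and P2: "\<And>x. x \<in> I \<Longrightarrow> (P1 has_vector_derivative P2 x) (at x)"
    and P3: "\<And>x. x \<in> I \<Longrightarrow> (P2 has_vector_derivative P3 x) (at x)"
    and eq: "\<And>x. x \<in> I \<Longrightarrow> P3 x - 2 * P x * P2 x + 3 * (P1 x)^2
          - 4 / (36 - (2/3)^2) * (6 * P1 x - (P x)^2)^2 = 0"
    using chazy unfolding generalised_chazy_def by metis
  have Q: "Q x = P x * P x - 6 * P1 x" if "x \<in> I" for x
    using vector_derivative_at[OF P1[OF that]] by (simp add: Q_def power2_eq_square)
  show "(P has_vector_derivative 1/6 * ((P x)^2 - Q x)) (at x)"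
    using P1[OF assms] by (simp add: Q[OF assms] power2_eq_square)
  have dQ: "(Q has_vector_derivative 2 * P x * P1 x - 6 * P2 x) (at x)" if "x \<in> I" for x
    by (rule has_vector_derivative_transform_within_open[OF _ open_I that Q[symmetric]])
      (auto intro!: derivative_eq_intros P1 P2 that simp: algebra_simps)
  have R: "R x = P x * Q x - 3 * (P x * P1 x) + 9 * P2 x" if "x \<in> I" for x
    unfolding R_def vector_derivative_at[OF dQ[OF that]] by (simp add: algebra_simps)
  show "(Q has_vector_derivative 2/3 * (P x * Q x - R x)) (at x)"
    using dQ[OF assms] by (simp add: R[OF assms] algebra_simps)
  have "(R has_vector_derivative P x * (2 * P x * P1 x - 6 * P2 x) + P1 x * Q x - 3 * (P x * P2 x + P1 x * P1 x) + 9 * P3 x) (at x)"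
    by (rule has_vector_derivative_transform_within_open[OF _ open_I assms R[symmetric]])
      (auto intro!: derivative_eq_intros P1 P2 P3 dQ assms simp: algebra_simps)
  \<comment> \<open>Here k = 2/3 gives 4 / (36 - k^2) = 9/80. In the derivative of \<open>R\<close>
    the other terms contribute P R - Q^2, and 9 * 9/80 - 1 = 1/80.\<close>
  moreover have "P3 x = 2 * P x * P2 x - 3 * (P1 x)^2 + 9/80 * (6 * P1 x - (P x)^2)^2"
    using eq[OF assms] by (simp add: power2_eq_square algebra_simps)
  ultimately show "(R has_vector_derivative P x * R x + 1/80 * (Q x)^2) (at x)"
    by (simp add: R[OF assms] Q[OF assms] power2_eq_square algebra_simps)
qed

text \<open>The linear equation enters as the Riccati equation of its logarithmic derivative, which
  is polynomial in the generators.\<close>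

lemma eta_system:
  assumes "x \<in> I" "\<eta> x \<noteq> 0"
  shows "(\<eta> has_vector_derivative \<xi> x * \<eta> x) (at x)"
    and "((\<lambda>x. 1 / \<eta> x) has_vector_derivative - (\<xi> x * (1 / \<eta> x))) (at x)"
    and "(\<xi> has_vector_derivative 1/40 * Q x - (\<xi> x)^2) (at x)"
    and "(chi has_vector_derivative (1 / \<eta> x)^2) (at x)"
proof -
  obtain e1 e2 where e1: "\<And>x. x \<in> I \<Longrightarrow> (\<eta> has_vector_derivative e1 x) (at x)"
    and e2: "\<And>x. x \<in> I \<Longrightarrow> (e1 has_vector_derivative e2 x) (at x)"
    and eq: "\<And>x. x \<in> I \<Longrightarrow> e2 x - 1/40 * Q x * \<eta> x = 0"
    using eta unfolding eta_equation_def by metis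
  \<comment> \<open>This holds at zeros of \<open>\<eta>\<close> too, where both sides are 0 by the
    convention for division; hence it may be used on all of \<open>I\<close>.\<close>
  have \<xi>: "\<xi> x = e1 x * (1 / \<eta> x)" if "x \<in> I" for x
    using vector_derivative_at[OF e1[OF that]] by (simp add: \<xi>_def)
  show "(\<eta> has_vector_derivative \<xi> x * \<eta> x) (at x)"
    using e1[OF assms(1)] assms(2) by (simp add: \<xi>[OF assms(1)])
  show inv: "((\<lambda>x. 1 / \<eta> x) has_vector_derivative - (\<xi> x * (1 / \<eta> x))) (at x)"
    using has_vector_derivative_inverse[OF e1[OF assms(1)] assms(2)]
    by (simp add: \<xi>[OF assms(1)] power2_eq_square)
  have "(\<xi> has_vector_derivative e1 x * - (\<xi> x * (1 / \<eta> x)) + e2 x * (1 / \<eta> x)) (at x)"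
    by (rule has_vector_derivative_transform_within_open[OF _ open_I assms(1) \<xi>[symmetric]])
      (intro has_vector_derivative_mult e2 inv assms)
  moreover have "e2 x = 1/40 * Q x * \<eta> x" using eq[OF assms(1)] by simp
  ultimately show "(\<xi> has_vector_derivative 1/40 * Q x - (\<xi> x)^2) (at x)"
    using assms(2) by (simp add: \<xi>[OF assms(1)] power2_eq_square)
  show "(chi has_vector_derivative (1 / \<eta> x)^2) (at x)"
    using chi assms by (simp add: power_divide)
qed

definition E where "E x = exp (IP x / 2)"
definition F where "F x = exp (- IP x / 2)"

lemma EF: "E x * F x = 1"
  by (simp add: E_def F_def exp_minus_inverse)

lemma exp_system:
  assumes "x \<in> I"
  shows "(E has_vector_derivative 1/2 * P x * E x) (at x)" "(F has_vector_derivative - (1/2 * P x * F x)) (at x)"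
proof -
  have "((\<lambda>x. IP x / 2) has_vector_derivative P x / 2) (at x)"
    "((\<lambda>x. - IP x / 2) has_vector_derivative - P x / 2) (at x)"
    using IP assms by (auto intro!: derivative_eq_intros)
  from this[THEN has_vector_derivative_exp]
  show "(E has_vector_derivative 1/2 * P x * E x) (at x)" "(F has_vector_derivative - (1/2 * P x * F x)) (at x)"
    by (simp_all add: E_def[abs_def] F_def[abs_def])
qed

text \<open>The algebra has no division, so 1 / \<open>\<eta>\<close> and \<open>F\<close>, the
  inverse of \<open>E\<close>, are generators of their own.\<close>

definition \<Phi> :: "(real \<Rightarrow> 'a) set" where
  "\<Phi> = {P, Q, R, \<xi>, \<eta>, \<lambda>x. 1 / \<eta> x, E, F, chi}"

definition G :: "(real^5 \<Rightarrow> 'a) set" where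
  "G = range (\<lambda>i u. of_real (u $ i)) \<union> (\<lambda>\<phi> u. \<phi> (u $ 1)) ` \<Phi>"

lemma derivatives:
  assumes "u \<in> U"
  shows "(P has_vector_derivative 1/6 * ((P (u$1))^2 - Q (u$1))) (at (u$1))"
    and "(Q has_vector_derivative 2/3 * (P (u$1) * Q (u$1) - R (u$1))) (at (u$1))"
    and "(R has_vector_derivative P (u$1) * R (u$1) + 1/80 * (Q (u$1))^2) (at (u$1))"
    and "(\<xi> has_vector_derivative 1/40 * Q (u$1) - (\<xi> (u$1))^2) (at (u$1))"
    and "(\<eta> has_vector_derivative \<xi> (u$1) * \<eta> (u$1)) (at (u$1))"
    and "((\<lambda>x. 1 / \<eta> x) has_vector_derivative - (\<xi> (u$1) * (1 / \<eta> (u$1)))) (at (u$1))"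
    and "(E has_vector_derivative 1/2 * P (u$1) * E (u$1)) (at (u$1))"
    and "(F has_vector_derivative - (1/2 * P (u$1) * F (u$1))) (at (u$1))"
    and "(chi has_vector_derivative (1 / \<eta> (u$1))^2) (at (u$1))"
  using U assms chazy_system eta_system exp_system by blast+

lemmas differentiable_x = derivatives[THEN differentiableI_vector]

lemma G_gen:
  "(\<lambda>u. of_real (u $ i)) \<in> alg U G" "\<phi> \<in> \<Phi> \<Longrightarrow> (\<lambda>u. \<phi> (u $ 1)) \<in> alg U G"
  by (auto simp: G_def intro!: alg.gen)

lemma gen_A:
  "(\<lambda>u. P (u$1)) \<in> alg U G" "(\<lambda>u. Q (u$1)) \<in> alg U G" "(\<lambda>u. R (u$1)) \<in> alg U G"
  "(\<lambda>u. \<xi> (u$1)) \<in> alg U G" "(\<lambda>u. \<eta> (u$1)) \<in> alg U G" "(\<lambda>u. 1 / \<eta> (u$1)) \<in> alg U G"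
  "(\<lambda>u. E (u$1)) \<in> alg U G" "(\<lambda>u. F (u$1)) \<in> alg U G" "(\<lambda>u. chi (u$1)) \<in> alg U G"
  using G_gen(2) by (auto simp: \<Phi>_def)

sublocale differential_algebra U G
  unfolding G_def
proof (rule differential_algebra_of_x[OF open_U], fold G_def)
  fix \<phi> assume "\<phi> \<in> \<Phi>"
  have *: "\<exists>\<psi>. (\<lambda>u. \<psi> (u $ 1)) \<in> alg U G \<and>
      (\<forall>u\<in>U. (\<phi> has_vector_derivative \<psi> (u $ 1)) (at (u $ 1)) \<and> \<psi> differentiable (at (u $ 1)))"
    if "(\<lambda>u. \<psi> (u $ 1)) \<in> alg U G" "\<And>u. u \<in> U \<Longrightarrow> (\<phi> has_vector_derivative \<psi> (u $ 1)) (at (u $ 1))"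
      "\<And>u. u \<in> U \<Longrightarrow> \<psi> differentiable (at (u $ 1))" for \<phi> \<psi>
    using that by blast
  note rules = alg_intros gen_A derivatives differentiable_x differentiable_mult differentiable_add
    differentiable_diff differentiable_minus differentiable_const differentiable_power
  show "\<exists>\<psi>. (\<lambda>u. \<psi> (u $ 1)) \<in> alg U G \<and>
      (\<forall>u\<in>U. (\<phi> has_vector_derivative \<psi> (u $ 1)) (at (u $ 1)) \<and> \<psi> differentiable (at (u $ 1)))"
    using \<open>\<phi> \<in> \<Phi>\<close> unfolding \<Phi>_def insert_iff empty_iff
  proof (elim disjE, goal_cases)
    case 1 show ?case
      unfolding 1 by (rule *[of "\<lambda>x. 1/6 * ((P x)^2 - Q x)"]) (intro rules | assumption)+
  next
    case 2 show ?case
      unfolding 2 by (rule *[of "\<lambda>x. 2/3 * (P x * Q x - R x)"]) (intro rules | assumption)+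
  next
    case 3 show ?case
      unfolding 3 by (rule *[of "\<lambda>x. P x * R x + 1/80 * (Q x)^2"]) (intro rules | assumption)+
  next
    case 4 show ?case
      unfolding 4 by (rule *[of "\<lambda>x. 1/40 * Q x - (\<xi> x)^2"]) (intro rules | assumption)+
  next
    case 5 show ?case
      unfolding 5 by (rule *[of "\<lambda>x. \<xi> x * \<eta> x"]) (intro rules | assumption)+
  next
    case 6 show ?case
      unfolding 6 by (rule *[of "\<lambda>x. - (\<xi> x * (1 / \<eta> x))"]) (intro rules | assumption)+
  next
    case 7 show ?case
      unfolding 7 by (rule *[of "\<lambda>x. 1/2 * P x * E x"]) (intro rules | assumption)+
  next
    case 8 show ?case
      unfolding 8 by (rule *[of "\<lambda>x. - (1/2 * P x * F x)"]) (intro rules | assumption)+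
  next
    case 9 show ?case
      unfolding 9 by (rule *[of "\<lambda>x. (1 / \<eta> x)^2"]) (intro rules | assumption)+
  qed blast
qed

lemma dir_x: "(\<phi> has_vector_derivative d) (at (u $ 1)) \<Longrightarrow> dir X (\<lambda>u. \<phi> (u $ 1)) u = X u $ 1 * d"
  by (simp add: dir_def partial_deriv_x if_distrib cong: if_cong)

lemma dir_coordinate: "dir X (\<lambda>u. of_real (u $ j)) u = X u $ j"
  by (simp add: dir_def partial_deriv_coordinate axis_def if_distrib cong: if_cong)

lemmas dir_gen = derivatives[THEN dir_x]

abbreviation yy :: "real^5 \<Rightarrow> 'a" where "yy u \<equiv> of_real (u $ 2)"
abbreviation zz :: "real^5 \<Rightarrow> 'a" where "zz u \<equiv> of_real (u $ 3)"
abbreviation pp :: "real^5 \<Rightarrow> 'a" where "pp u \<equiv> of_real (u $ 4)"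
abbreviation qq :: "real^5 \<Rightarrow> 'a" where "qq u \<equiv> of_real (u $ 5)"

text \<open>With \<open>Y = y / E\<close> and \<open>r = E * q\<close> in place of \<open>y\<close> and \<open>q\<close>, all identities below are
  polynomial in \<open>P\<close>, \<open>Q\<close>, \<open>R\<close>, \<open>\<xi>\<close>, \<open>Y\<close>, \<open>p\<close>, \<open>r\<close>, up to powers of \<open>\<eta>\<close>.\<close>

definition Y where "Y u = F (u $ 1) * yy u"
definition r where "r u = E (u $ 1) * qq u"
definition g where "g x = 6 * \<xi> x + P x"
definition W where "W u = (1 / \<eta> (u $ 1))^3 * Y u"
definition j where "j u = 1/6 * ((g (u$1))^2 + 1/20 * Q (u$1)) * Y u - 1/2 * (8 * \<xi> (u$1) + P (u$1)) * pp u + r u"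
definition b where "b u = pp u - 1/2 * g (u$1) * Y u"
definition M where "M u = - 4 * g (u$1) * (pp u)^2 + 2 * (g (u$1))^2 * Y u * pp u - 1/3 * (g (u$1))^3 * (Y u)^2
  + P (u$1) * (pp u)^2 + 1/10 * Q (u$1) * Y u * pp u + 1/30 * R (u$1) * (Y u)^2"
definition \<kappa> where "\<kappa> u =
  2/9 * (216 * (\<xi> (u$1))^3 + 108 * P (u$1) * (\<xi> (u$1))^2 + 18 * ((P (u$1))^2 + 1/20 * Q (u$1)) * \<xi> (u$1)
    + (P (u$1))^3 + 3/20 * P (u$1) * Q (u$1) + 1/5 * R (u$1)) * Y u
  - 2 * (24 * (\<xi> (u$1))^2 + 6 * P (u$1) * \<xi> (u$1) + 1/3 * ((P (u$1))^2 - 1/10 * Q (u$1))) * pp u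
  + 24 * \<xi> (u$1) * r u"

lemma exp_IP: "exp (IP x) = (E x)^2" "exp (- IP x) = (F x)^2"
  by (simp_all add: E_def F_def power2_eq_square exp_add[symmetric])

lemma fold_exp: "exp (IP x / 2) = E x" "exp (- IP x / 2) = F x" "exp (- (IP x / 2)) = F x"
  by (simp_all add: E_def F_def)

lemma EF': "E x * (F x * c) = c" "F x * (E x * c) = c" "F x * E x = 1"
  by (simp_all only: mult.assoc[symmetric] mult.commute[of "F x" "E x"] EF mult_1_left)

lemma J_eq: "J u = \<eta> (u$1) * j u"
  by (simp add: J_def j_def T_def g_def Let_def fold_exp Y_def r_def algebra_simps)

lemma B_eq: "B u = 1 / \<eta> (u$1) * b u"
  by (simp add: B_def b_def g_def Let_def fold_exp Y_def diff_divide_distrib mult.assoc)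

lemma c1_eq: "c1 u = 1/8 * J u * (chi (u$1))^2 - 1/8 * B u * chi (u$1) - 3/8 * W u"
  by (simp add: c1_def W_def Y_def Let_def fold_exp power_divide)

lemma c2_eq: "c2 u = 6 * zz u + 6 * chi (u$1) * (J u)^2 - 16 * B u * J u + M u"
  by (simp add: c2_def M_def g_def Y_def Let_def fold_exp exp_IP power_mult_distrib algebra_simps)

lemma K_eq: "K u = F (u$1) * \<kappa> u"
  by (simp add: K_def \<kappa>_def Y_def r_def Let_def fold_exp exp_IP power2_eq_square[of "F _"] EF' algebra_simps)

lemma Y_A: "Y \<in> A" and r_A: "r \<in> A"
  unfolding Y_def[abs_def] r_def[abs_def] by (intro alg_intros gen_A G_gen)+

lemma WjbM_A: "W \<in> A" "j \<in> A" "b \<in> A" "M \<in> A" "\<kappa> \<in> A"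
  unfolding W_def[abs_def] j_def[abs_def] b_def[abs_def] M_def[abs_def] \<kappa>_def[abs_def] g_def
  by (intro alg_intros gen_A G_gen Y_A r_A)+

lemma JB_A: "J \<in> A" "B \<in> A"
  unfolding J_eq[abs_def] B_eq[abs_def] by (intro alg_intros gen_A WjbM_A)+

lemma c_A: "c1 \<in> A" "c2 \<in> A" "c3 \<in> A" "K \<in> A"
  unfolding c1_eq[abs_def] c2_eq[abs_def] c3_def[abs_def] K_eq[abs_def]
  by (intro alg_intros gen_A G_gen WjbM_A JB_A | simp)+

lemmas mem_A = alg_intros gen_A G_gen(1) Y_A r_A WjbM_A JB_A c_A

lemma dir_Y: "u \<in> U \<Longrightarrow> dir X Y u = F (u$1) * X u $ 2 - 1/2 * P (u$1) * Y u * X u $ 1"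
  unfolding Y_def[abs_def]
  by (simp only: dir_simps mem_A dir_gen dir_coordinate) (simp add: algebra_simps)

lemma dir_r: "u \<in> U \<Longrightarrow> dir X r u = E (u$1) * X u $ 5 + 1/2 * P (u$1) * r u * X u $ 1"
  unfolding r_def[abs_def]
  by (simp only: dir_simps mem_A dir_gen dir_coordinate) (simp add: algebra_simps)

lemma dir_g: "u \<in> U \<Longrightarrow> dir X (\<lambda>u. g (u $ 1)) u =
    X u $ 1 * (6 * (1/40 * Q (u$1) - (\<xi> (u$1))^2) + 1/6 * ((P (u$1))^2 - Q (u$1)))"
  unfolding g_def by (simp only: dir_simps mem_A dir_gen) (simp add: algebra_simps)

lemma g_A: "(\<lambda>u. g (u $ 1)) \<in> A"
  unfolding g_def by (intro mem_A)

lemma dir_j: "u \<in> U \<Longrightarrow> dir X j u =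
    1/6 * (2 * g (u$1) * dir X (\<lambda>u. g (u $ 1)) u + 1/20 * (X u $ 1 * (2/3 * (P (u$1) * Q (u$1) - R (u$1))))) * Y u
    + 1/6 * ((g (u$1))^2 + 1/20 * Q (u$1)) * dir X Y u
    - 1/2 * (X u $ 1 * (8 * (1/40 * Q (u$1) - (\<xi> (u$1))^2) + 1/6 * ((P (u$1))^2 - Q (u$1)))) * pp u
    - 1/2 * (8 * \<xi> (u$1) + P (u$1)) * X u $ 4 + dir X r u"
  unfolding j_def[abs_def]
  by (simp only: dir_simps mem_A g_A dir_gen dir_coordinate) (simp add: algebra_simps)

lemma dir_b: "u \<in> U \<Longrightarrow> dir X b u =
    X u $ 4 - 1/2 * dir X (\<lambda>u. g (u $ 1)) u * Y u - 1/2 * g (u$1) * dir X Y u"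
  unfolding b_def[abs_def]
  by (simp only: dir_simps mem_A g_A dir_gen dir_coordinate) (simp add: algebra_simps)

lemma dir_W: "u \<in> U \<Longrightarrow> dir X W u = (1 / \<eta> (u$1))^3 * (dir X Y u - 3 * X u $ 1 * \<xi> (u$1) * Y u)"
  unfolding W_def[abs_def]
  by (simp only: dir_simps mem_A dir_gen) (simp add: eval_nat_numeral algebra_simps)

lemma dir_M: "u \<in> U \<Longrightarrow> dir X M u =
    dir X (\<lambda>u. g (u $ 1)) u * (- 4 * (pp u)^2 + 4 * g (u$1) * Y u * pp u - (g (u$1))^2 * (Y u)^2)
    + X u $ 1 * (1/6 * ((P (u$1))^2 - Q (u$1)) * (pp u)^2 + 1/10 * (2/3 * (P (u$1) * Q (u$1) - R (u$1))) * Y u * pp u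
      + 1/30 * (P (u$1) * R (u$1) + 1/80 * (Q (u$1))^2) * (Y u)^2)
    + dir X Y u * (2 * (g (u$1))^2 * pp u - 2/3 * (g (u$1))^3 * Y u + 1/10 * Q (u$1) * pp u + 1/15 * R (u$1) * Y u)
    + X u $ 4 * (- 8 * g (u$1) * pp u + 2 * (g (u$1))^2 * Y u + 2 * P (u$1) * pp u + 1/10 * Q (u$1) * Y u)"
  unfolding M_def[abs_def]
  by (simp only: dir_simps mem_A g_A dir_gen dir_coordinate) (simp add: eval_nat_numeral algebra_simps)

lemma dir_J: "u \<in> U \<Longrightarrow> dir X J u = \<eta> (u$1) * (X u $ 1 * \<xi> (u$1) * j u + dir X j u)"
  unfolding J_eq[abs_def]
  by (simp only: dir_simps mem_A dir_gen) (simp add: algebra_simps)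

lemma dir_B: "u \<in> U \<Longrightarrow> dir X B u = 1 / \<eta> (u$1) * (dir X b u - X u $ 1 * \<xi> (u$1) * b u)"
  unfolding B_eq[abs_def]
  by (simp only: dir_simps mem_A dir_gen) (simp add: diff_divide_distrib)

lemma dir_c2: "u \<in> U \<Longrightarrow> dir X c2 u = 6 * X u $ 3 + 6 * (X u $ 1 * (1 / \<eta> (u$1))^2) * (J u)^2
    + 12 * chi (u$1) * J u * dir X J u - 16 * dir X B u * J u - 16 * B u * dir X J u + dir X M u"
  unfolding c2_eq[abs_def]
  by (simp only: dir_simps mem_A dir_gen dir_coordinate) (simp add: algebra_simps)

section \<open>Derivatives along \<open>S1\<close>, \<open>S2\<close> and an auxiliary field
  \<open>S0\<close>\<close>

lemma S1_components:
  "S1 u $ 1 = - (8 * (\<eta> (u$1))^2)" "S1 u $ 2 = - (8 * (\<eta> (u$1))^2) * (E (u$1) * pp u)"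
  "S1 u $ 3 = - (8 * (\<eta> (u$1))^2) * (r u)^2" "S1 u $ 4 = - (8 * (\<eta> (u$1))^2) * r u"
  "S1 u $ 5 = - ((\<eta> (u$1))^2 * (F (u$1) * \<kappa> u))"
  by (simp_all add: S1_def X1_def X2_def K_eq axis_def Let_def fold_exp exp_IP r_def power_mult_distrib)

lemma S2_components:
  "S2 u $ 1 = 0" "S2 u $ 2 = 0" "S2 u $ 3 = 0" "S2 u $ 4 = 0" "S2 u $ 5 = 1/4 * (F (u$1) * (1 / \<eta> (u$1)))"
  by (simp_all add: S2_def X1_def axis_def fold_exp)

text \<open>What remains of \<open>S3\<close> after splitting off multiples of \<open>S1\<close> and
  \<open>S2\<close>: the \<open>X1\<close>-part of \<open>l3\<close> proportional to the square of
  \<open>c3\<close> is absorbed into \<open>X3\<close>, and the resulting field annihilates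
  \<open>J\<close> and \<open>chi\<close>.\<close>

definition S0 :: "real^5 \<Rightarrow> 'a^5" where
  "S0 u = X3 u - (\<eta> (u$1) * F (u$1) *
     ((6 * (\<xi> (u$1))^2 + 3/2 * P (u$1) * \<xi> (u$1) + 1/12 * ((P (u$1))^2 - 1/10 * Q (u$1))) * (\<eta> (u$1))^2 * chi (u$1)
       - 4 * \<xi> (u$1) - 1/2 * P (u$1))) *s X1 u"

lemma S0_components:
  "S0 u $ 1 = 0"
  "S0 u $ 2 = - ((\<eta> (u$1))^3 * chi (u$1) * E (u$1))"
  "S0 u $ 3 = (\<eta> (u$1))^3 * chi (u$1) *
      ((12 * (\<xi> (u$1))^3 + 6 * P (u$1) * (\<xi> (u$1))^2 + ((P (u$1))^2 + 1/20 * Q (u$1)) * \<xi> (u$1)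
          + 1/18 * (P (u$1))^3 + 1/120 * P (u$1) * Q (u$1) + 1/90 * R (u$1)) * Y u
        - (12 * (\<xi> (u$1))^2 + 3 * P (u$1) * \<xi> (u$1) + 1/6 * (P (u$1))^2 - 1/60 * Q (u$1)) * pp u)
    + \<eta> (u$1) * (1/3 * ((g (u$1))^2 + 1/20 * Q (u$1)) * Y u - (8 * \<xi> (u$1) + P (u$1)) * pp u + 4 * r u)"
  "S0 u $ 4 = \<eta> (u$1) - 1/2 * (\<eta> (u$1))^3 * chi (u$1) * g (u$1)"
  "S0 u $ 5 = - (\<eta> (u$1) * F (u$1) *
     ((6 * (\<xi> (u$1))^2 + 3/2 * P (u$1) * \<xi> (u$1) + 1/12 * ((P (u$1))^2 - 1/10 * Q (u$1))) * (\<eta> (u$1))^2 * chi (u$1)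
       - 4 * \<xi> (u$1) - 1/2 * P (u$1)))"
  by (simp_all add: S0_def X3_def X1_def axis_def Let_def fold_exp r_def Y_def g_def T_def algebra_simps)

lemma S3_eq:
  assumes "\<eta> (u$1) \<noteq> 0"
  shows "S3 u = c2 u *s S2 u - c1 u *s S1 u - (c3 u)^2 *s S0 u"
proof -
  \<comment> \<open>The coefficient of \<open>X2\<close> in \<open>S3\<close> must match that of -
    c1 S1, and \<open>X2\<close> occurs in \<open>S1\<close> with factor - 8 \<open>\<eta>\<close>
    squared.\<close>
  have coeff: "(1/6 * T (u$1) * exp (- IP (u$1) / 2) * yy u - 1/2 * (8 * \<xi> (u$1) + P (u$1)) * pp u + exp (IP (u$1) / 2) * qq u)
          * (\<eta> (u$1))^3 * (chi (u$1))^2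
        + (1/2 * (6 * \<xi> (u$1) + P (u$1)) * exp (- IP (u$1) / 2) * yy u - pp u) * \<eta> (u$1) * chi (u$1)
        - 3 / \<eta> (u$1) * exp (- IP (u$1) / 2) * yy u = 8 * (\<eta> (u$1))^2 * c1 u" (is "?c = _")
  proof -
    have "?c = j u * (\<eta> (u$1))^3 * (chi (u$1))^2 - b u * \<eta> (u$1) * chi (u$1) - 3 / \<eta> (u$1) * Y u"
      by (simp add: fold_exp j_def b_def T_def g_def Y_def r_def algebra_simps)
    also have "\<dots> = 8 * (\<eta> (u$1))^2 * c1 u"
      unfolding c1_eq J_eq B_eq W_def using assms by (simp add: field_simps power2_eq_square power3_eq_cube)
    finally show ?thesis .
  qed
  show ?thesis
    unfolding S3_def Let_def fold_exp
    unfolding coeff[unfolded fold_exp] S1_def S2_def S0_def l3_def Let_def fold_exp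
    by (simp add: vec_eq_iff algebra_simps)
qed

lemma dir_S1_Y: "u \<in> U \<Longrightarrow> dir S1 Y u = - 8 * (\<eta> (u$1))^2 * (pp u - 1/2 * P (u$1) * Y u)"
  and dir_S1_r: "u \<in> U \<Longrightarrow> dir S1 r u = - ((\<eta> (u$1))^2) * (\<kappa> u + 4 * P (u$1) * r u)"
  by (simp_all add: dir_Y dir_r S1_components EF' algebra_simps)

text \<open>The \<open>X1\<close>-coefficient \<open>K\<close> of \<open>S1\<close> is exactly the
  vertical correction that keeps \<open>J\<close> constant.\<close>

lemma dir_S1_J: "u \<in> U \<Longrightarrow> dir S1 J u = 0"
  unfolding dir_J dir_j dir_S1_Y dir_S1_r dir_g S1_components(1,4)
  unfolding j_def \<kappa>_def g_def
  by (simp add: field_simps power2_eq_square power3_eq_cube)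

lemma dir_S1_B: "u \<in> U \<Longrightarrow> dir S1 B u = - 8 * J u"
  unfolding dir_B dir_b dir_S1_Y dir_g S1_components(1,4)
  unfolding J_eq j_def b_def g_def
  using U by (simp add: field_simps power2_eq_square power3_eq_cube)

lemma dir_S1_W: "u \<in> U \<Longrightarrow> dir S1 W u = - 8 * B u"
  unfolding dir_W dir_S1_Y S1_components(1,4)
  unfolding B_eq b_def g_def
  using U by (simp add: field_simps power2_eq_square power3_eq_cube)

text \<open>The square of \<open>r\<close> is cancelled in \<open>c2\<close> by the derivative of
  6z. The coefficient of \<open>Y\<close> squared involves the derivative of \<open>R\<close>, so k
  = 2/3 enters through 1/80.\<close>

lemma dir_S1_M: "u \<in> U \<Longrightarrow> dir S1 M u = - 8 * (\<eta> (u$1))^2 * (6 * (j u)^2 - 6 * (r u)^2)"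
  unfolding dir_M dir_S1_Y dir_g S1_components(1,4)
  unfolding j_def g_def
  by (simp add: algebra_simps power2_eq_square power3_eq_cube)

lemma dir_S1_c2: "u \<in> U \<Longrightarrow> dir S1 c2 u = 32 * (J u)^2"
  unfolding dir_c2 dir_S1_J dir_S1_B dir_S1_M S1_components
  unfolding J_eq using U by (simp add: field_simps power2_eq_square)

lemma dir_S1_chi: "u \<in> U \<Longrightarrow> dir S1 (\<lambda>u. chi (u$1)) u = - 8"
  using U by (simp add: dir_gen S1_components power_divide)

lemma dir_S2_Y: "u \<in> U \<Longrightarrow> dir S2 Y u = 0"
  and dir_S2_r: "u \<in> U \<Longrightarrow> dir S2 r u = 1/4 * (1 / \<eta> (u$1))"
  and dir_S2_chi: "u \<in> U \<Longrightarrow> dir S2 (\<lambda>u. chi (u$1)) u = 0"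
  by (simp_all only: dir_Y dir_r dir_gen S2_components) (simp_all add: EF EF' mult.left_commute)

lemma dir_S2_J: "u \<in> U \<Longrightarrow> dir S2 J u = 1/4"
  and dir_S2_B: "u \<in> U \<Longrightarrow> dir S2 B u = 0"
  and dir_S2_W: "u \<in> U \<Longrightarrow> dir S2 W u = 0"
  and dir_S2_c2: "u \<in> U \<Longrightarrow> dir S2 c2 u = 3 * chi (u$1) * J u - 4 * B u"
  using U by (simp_all add: dir_J dir_j dir_B dir_b dir_W dir_c2 dir_M dir_S2_Y dir_S2_r dir_g S2_components)

lemma dir_S0_Y: "u \<in> U \<Longrightarrow> dir S0 Y u = - ((\<eta> (u$1))^3 * chi (u$1))"
  and dir_S0_r: "u \<in> U \<Longrightarrow> dir S0 r u = - (\<eta> (u$1) *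
     ((6 * (\<xi> (u$1))^2 + 3/2 * P (u$1) * \<xi> (u$1) + 1/12 * ((P (u$1))^2 - 1/10 * Q (u$1))) * (\<eta> (u$1))^2 * chi (u$1)
       - 4 * \<xi> (u$1) - 1/2 * P (u$1)))"
  and dir_S0_chi: "u \<in> U \<Longrightarrow> dir S0 (\<lambda>u. chi (u$1)) u = 0"
  and dir_S0_g: "u \<in> U \<Longrightarrow> dir S0 (\<lambda>u. g (u$1)) u = 0"
  by (simp_all only: dir_Y dir_r dir_gen dir_g S0_components) (simp_all add: EF EF' mult.left_commute mult.assoc)

lemma dir_S0_J: "u \<in> U \<Longrightarrow> dir S0 J u = 0"
  unfolding dir_J dir_j dir_S0_Y dir_S0_r dir_S0_g S0_components(1,4)
  unfolding g_def by (simp add: field_simps power2_eq_square power3_eq_cube)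

lemma dir_S0_B: "u \<in> U \<Longrightarrow> dir S0 B u = 1"
  unfolding dir_B dir_b dir_S0_Y dir_S0_g S0_components(1,4)
  using U by (simp add: field_simps)

lemma dir_S0_W: "u \<in> U \<Longrightarrow> dir S0 W u = - chi (u$1)"
  unfolding dir_W dir_S0_Y S0_components(1) using U by (simp add: power_divide)

text \<open>The z-coefficient of \<open>S0\<close> is designed to cancel against the derivative of
  6z in \<open>c2\<close>, leaving a multiple of \<open>J\<close>.\<close>

lemma dir_S0_M: "u \<in> U \<Longrightarrow> dir S0 M u = 24 * J u - 6 * S0 u $ 3"
  unfolding dir_M dir_S0_Y dir_S0_g S0_components
  unfolding J_eq j_def g_def by (simp add: field_simps power2_eq_square power3_eq_cube)

lemma dir_S0_c2: "u \<in> U \<Longrightarrow> dir S0 c2 u = 8 * J u"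
  by (simp add: dir_c2 dir_S0_J dir_S0_B dir_S0_M S0_components(1))

section \<open>Coordinates on the null quadric and the three lifts\<close>

text \<open>Equals 8 c1 + 2 c3 chi, the terms with J chi^2 cancelling. Since 8 c1 and c2 / 4 are the
  derivatives of \<open>chi\<close> and \<open>J\<close> along \<open>S3\<close>, adding 2 c3 times
  the function gives \<open>m\<close> and \<open>n\<close>, which \<open>S3\<close> merely
  rescales.\<close>

definition m where "m u = B u * chi (u$1) - 3 * W u"
definition n where "n u = 1/4 * c2 u + 2 * c3 u * J u"
definition N where "N u = (c3 u)^2 + 1/2 * (m u * J u - n u * chi (u$1))"

lemma mnN_A: "m \<in> A" "n \<in> A" "N \<in> A"
  unfolding m_def[abs_def] n_def[abs_def] N_def[abs_def] by (intro mem_A)+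

lemma dir_c3: "u \<in> U \<Longrightarrow> dir X c3 u =
    dir X B u - 1/2 * (dir X J u * chi (u$1) + J u * dir X (\<lambda>u. chi (u$1)) u)"
  unfolding c3_def[abs_def] by (simp only: dir_simps mem_A) (simp add: algebra_simps)

lemma dir_m: "u \<in> U \<Longrightarrow> dir X m u =
    dir X B u * chi (u$1) + B u * dir X (\<lambda>u. chi (u$1)) u - 3 * dir X W u"
  unfolding m_def[abs_def] by (simp only: dir_simps mem_A) simp

lemma dir_n: "u \<in> U \<Longrightarrow> dir X n u = 1/4 * dir X c2 u + 2 * (dir X c3 u * J u + c3 u * dir X J u)"
  unfolding n_def[abs_def] by (simp only: dir_simps mem_A) (simp add: algebra_simps)

lemma dir_N: "u \<in> U \<Longrightarrow> dir X N u = 2 * c3 u * dir X c3 u + 1/2 * (dir X m u * J u + m u * dir X J u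
    - dir X n u * chi (u$1) - n u * dir X (\<lambda>u. chi (u$1)) u)"
  unfolding N_def[abs_def] by (simp only: dir_simps mem_A mnN_A) (simp add: algebra_simps)

lemma dir_S1:
  assumes "u \<in> U"
  shows "dir S1 c3 u = - 4 * J u" "dir S1 m u = 16 * c3 u" "dir S1 n u = 0" "dir S1 N u = 4 * n u"
proof -
  show c3: "dir S1 c3 u = - 4 * J u" and m: "dir S1 m u = 16 * c3 u"
    using assms by (simp_all add: dir_c3 dir_m dir_S1_J dir_S1_B dir_S1_W dir_S1_chi c3_def)
  show n: "dir S1 n u = 0"
    using assms by (simp add: dir_n c3 dir_S1_J dir_S1_c2 power2_eq_square)
  show "dir S1 N u = 4 * n u"
    using assms by (simp add: dir_N c3 m n dir_S1_J dir_S1_chi) (simp add: field_simps)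
qed

lemma dir_S2:
  assumes "u \<in> U"
  shows "dir S2 c3 u = - 1/8 * chi (u$1)" "dir S2 m u = 0" "dir S2 n u = - 1/2 * c3 u" "dir S2 N u = 1/8 * m u"
proof -
  show c3: "dir S2 c3 u = - 1/8 * chi (u$1)" and m: "dir S2 m u = 0"
    using assms by (simp_all add: dir_c3 dir_m dir_S2_J dir_S2_B dir_S2_W dir_S2_chi)
  show n: "dir S2 n u = - 1/2 * c3 u"
    using assms by (simp add: dir_n c3 dir_S2_J dir_S2_c2) (simp add: c3_def field_simps)
  show "dir S2 N u = 1/8 * m u"
    using assms by (simp add: dir_N c3 m n dir_S2_J dir_S2_chi) (simp add: field_simps)
qed

lemma dir_S3:
  assumes "u \<in> U"
  shows "dir S3 f u = c2 u * dir S2 f u - c1 u * dir S1 f u - (c3 u)^2 * dir S0 f u"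
proof -
  have "S3 u = c2 u *s S2 u - c1 u *s S1 u - (c3 u)^2 *s S0 u"
    using U assms by (intro S3_eq) blast
  thus ?thesis
    by (simp add: dir_def sum_distrib_left sum_subtractf left_diff_distrib mult.assoc)
qed

text \<open>The common summand - 2 c3 times the function is the projective part of the action; apart
  from it the values are linear in the coordinates of \<open>w\<close>.\<close>

lemma dir_S3_values:
  assumes "u \<in> U"
  shows "dir S3 (\<lambda>u. chi (u$1)) u = m u - 2 * c3 u * chi (u$1)" "dir S3 J u = n u - 2 * c3 u * J u"
    "dir S3 c3 u = N u - 2 * (c3 u)^2" "dir S3 m u = - 2 * c3 u * m u" "dir S3 n u = - 2 * c3 u * n u"
    "dir S3 N u = - 2 * c3 u * N u"
proof -
  have c1: "c1 u = 1/8 * (m u - 2 * c3 u * chi (u$1))"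
    by (simp add: c1_eq m_def c3_def algebra_simps power2_eq_square)
  have c2: "c2 u = 4 * n u - 8 * c3 u * J u"
    by (simp add: n_def)
  have S0: "dir S0 c3 u = 1" "dir S0 m u = 4 * chi (u$1)" "dir S0 n u = 4 * J u"
    using assms by (simp_all add: dir_c3 dir_m dir_n dir_S0_J dir_S0_B dir_S0_W dir_S0_c2 dir_S0_chi)
  show chi: "dir S3 (\<lambda>u. chi (u$1)) u = m u - 2 * c3 u * chi (u$1)" and J: "dir S3 J u = n u - 2 * c3 u * J u"
    using assms by (simp_all add: dir_S3 dir_S1_chi dir_S2_chi dir_S0_chi dir_S1_J dir_S2_J dir_S0_J c1 c2)
  show c3: "dir S3 c3 u = N u - 2 * (c3 u)^2"
    using assms by (simp add: dir_S3 dir_S1 dir_S2 S0 c1 c2 N_def field_simps power2_eq_square)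
  show m: "dir S3 m u = - 2 * c3 u * m u"
    using assms by (simp add: dir_S3 dir_S1 dir_S2 S0 c1 c2 field_simps power2_eq_square)
  show n: "dir S3 n u = - 2 * c3 u * n u"
    using assms by (simp add: dir_S3 dir_S1 dir_S2 S0 c1 c2 field_simps power2_eq_square)
  show "dir S3 N u = - 2 * c3 u * N u"
    using assms by (simp add: dir_N chi J c3 m n N_def field_simps power2_eq_square)
qed

text \<open>\<open>N\<close> makes \<open>w\<close> null; the factors 1/2 and the signs are those for which \<open>S1\<close>, \<open>S2\<close>, \<open>S3\<close>
  correspond to the first three entries of \<open>g2_basis\<close>.\<close>

definition w :: "real^5 \<Rightarrow> 'a zorn" where
  "w u = (c3 u, vector [m u, 1/2 * n u, 1], vector [1/2 * J u, - chi (u$1), - N u], - c3 u)"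

lemma zcoord_w:
  "(\<lambda>u. zcoord 0 (w u)) = c3" "(\<lambda>u. zcoord 1 (w u)) = m" "(\<lambda>u. zcoord 2 (w u)) = (\<lambda>u. 1/2 * n u)"
  "(\<lambda>u. zcoord 3 (w u)) = (\<lambda>u. 1)" "(\<lambda>u. zcoord 4 (w u)) = (\<lambda>u. 1/2 * J u)"
  "(\<lambda>u. zcoord 5 (w u)) = (\<lambda>u. - chi (u$1))" "(\<lambda>u. zcoord 6 (w u)) = (\<lambda>u. - N u)"
  "(\<lambda>u. zcoord 7 (w u)) = (\<lambda>u. - c3 u)"
  by (simp_all add: zcoord_def w_def)

text \<open>The coordinates are triangular in the components of \<open>X\<close>: \<open>chi\<close>
  determines the x-component, then \<open>m\<close> the y-component through \<open>W\<close>,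
  \<open>B\<close> the p-component, \<open>J\<close> the q-component and \<open>c2\<close> the
  z-component.\<close>

lemma immersion:
  assumes X: "X \<in> fields" and 0: "\<And>k u. k < 8 \<Longrightarrow> u \<in> U \<Longrightarrow> dir X (\<lambda>u. zcoord k (w u)) u = 0"
  shows "X = 0"
proof
  fix u
  show "X u = 0 u"
  proof (cases "u \<in> U")
    case True
    hence eta: "\<eta> (u$1) \<noteq> 0" using U by blast
    have EF0: "E (u$1) \<noteq> 0" "F (u$1) \<noteq> 0" by (simp_all add: E_def F_def)
    have c3: "dir X c3 u = 0" and m: "dir X m u = 0" and n: "dir X n u = 0" and J: "dir X J u = 0"
      and chi: "dir X (\<lambda>u. chi (u$1)) u = 0"
      using 0[of 0 u] 0[of 1 u] 0[of 2 u] 0[of 4 u] 0[of 5 u]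
      unfolding zcoord_w dir_mult[OF alg.const mnN_A(2) True] dir_mult[OF alg.const JB_A(1) True]
        dir_uminus[OF gen_A(9) True]
      by (simp_all add: True dir_const)
    have X1: "X u $ 1 = 0" using chi eta True by (simp add: dir_gen)
    have g: "dir X (\<lambda>u. g (u$1)) u = 0" using True by (simp add: dir_g X1)
    have B: "dir X B u = 0" using c3 J chi True by (simp add: dir_c3)
    have "dir X W u = 0" using m B chi True by (simp add: dir_m)
    hence Y: "dir X Y u = 0" using eta True by (simp add: dir_W X1)
    hence X2: "X u $ 2 = 0" using True EF0 by (simp add: dir_Y X1)
    have X4: "X u $ 4 = 0" using B eta True by (simp add: dir_B dir_b X1 Y g)
    have "dir X r u = 0" using J eta True by (simp add: dir_J dir_j X1 X4 Y g)
    hence X5: "X u $ 5 = 0" using True EF0 by (simp add: dir_r X1)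
    have "dir X c2 u = 0" using n c3 J True by (simp add: dir_n)
    hence "X u $ 3 = 0" using True by (simp add: dir_c2 dir_M B J X1 X4 Y g)
    thus ?thesis using X1 X2 X4 X5 by (simp add: vec_eq_iff forall_5)
  qed (use X in \<open>simp add: fields_def\<close>)
qed

sublocale octonion_section U G w
proof
  show "(\<lambda>u. zcoord k (w u)) \<in> A" if "k < 8" for k
  proof -
    have "\<forall>k<8. (\<lambda>u. zcoord k (w u)) \<in> A"
      unfolding all_less_8 zcoord_w by (intro conjI mem_A mnN_A)
    thus ?thesis using that by blast
  qed
  show "zcoord 3 (w u) = 1" for u by (simp add: zcoord_def w_def)
qed (rule immersion)

lemma restrict_field_in_fields:
  assumes "\<And>k. (\<lambda>u. X u $ k) \<in> A"
  shows "restrict_field U X \<in> fields"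
proof -
  have "(\<lambda>u. restrict_field U X u $ k) \<in> A" for k
    by (rule alg.cong[OF assms[of k]]) (simp add: restrict_field_def)
  thus ?thesis by (simp add: fields_def restrict_field_def)
qed

lemma S_fields: "restrict_field U S1 \<in> fields" "restrict_field U S2 \<in> fields" "restrict_field U S3 \<in> fields"
proof -
  have S1: "\<forall>k. (\<lambda>u. S1 u $ k) \<in> A"
    unfolding forall_5 S1_components by (intro conjI mem_A)
  have S2: "\<forall>k. (\<lambda>u. S2 u $ k) \<in> A"
    unfolding forall_5 S2_components by (intro conjI mem_A)
  have S0: "\<forall>k. (\<lambda>u. S0 u $ k) \<in> A"
    unfolding forall_5 S0_components by (intro conjI mem_A g_A)
  show "restrict_field U S1 \<in> fields" "restrict_field U S2 \<in> fields"
    using S1 S2 by (simp_all add: restrict_field_in_fields)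
  have "(\<lambda>u. c2 u * S2 u $ k - c1 u * S1 u $ k - (c3 u)^2 * S0 u $ k) \<in> A" for k
    by (intro mem_A S1[rule_format] S2[rule_format] S0[rule_format])
  hence "(\<lambda>u. S3 u $ k) \<in> A" for k
    by (rule alg.cong) (use U S3_eq in auto)
  thus "restrict_field U S3 \<in> fields" by (rule restrict_field_in_fields)
qed

lemma dir_restrict: "u \<in> U \<Longrightarrow> dir (restrict_field U X) f u = dir X f u"
  by (simp add: dir_def restrict_field_def)

lemma lifts_restrict:
  assumes "restrict_field U X \<in> fields" "l \<in> A"
    and "\<And>u. u \<in> U \<Longrightarrow> \<forall>k<8. dir X (\<lambda>u. zcoord k (w u)) u = zcoord k (zorn_scale (l u) (w u) - D (w u))"
  shows "lifts (restrict_field U X) D"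
  unfolding lifts_def using assms by (auto simp: dir_restrict)

lemma lifts_S1: "lifts (restrict_field U S1) (zder 0 (vector [- 8, 0, 0]) 0)"
proof (rule lifts_restrict[OF S_fields(1) alg.const[of 0]])
  fix u assume u: "u \<in> U"
  show "\<forall>k<8. dir S1 (\<lambda>u. zcoord k (w u)) u =
      zcoord k (zorn_scale 0 (w u) - zder 0 (vector [- 8, 0, 0]) 0 (w u))"
    unfolding all_less_8 zcoord_w
    by (simp only: dir_simps mem_A mnN_A u dir_S1 dir_S1_J dir_S1_chi)
      (simp add: zcoord_def w_def zorn_component_simps)
qed

lemma lifts_S2: "lifts (restrict_field U S2) (zder 0 (vector [0, 1/8, 0]) 0)"
proof (rule lifts_restrict[OF S_fields(2) alg.const[of 0]])
  fix u assume u: "u \<in> U"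
  show "\<forall>k<8. dir S2 (\<lambda>u. zcoord k (w u)) u =
      zcoord k (zorn_scale 0 (w u) - zder 0 (vector [0, 1/8, 0]) 0 (w u))"
    unfolding all_less_8 zcoord_w
    by (simp only: dir_simps mem_A mnN_A u dir_S2 dir_S2_J dir_S2_chi)
      (simp add: zcoord_def w_def zorn_component_simps)
qed

lemma lifts_S3: "lifts (restrict_field U S3) (zder 0 (vector [0, 0, - 1]) 0)"
proof (rule lifts_restrict[OF S_fields(3)])
  \<comment> \<open>The derivation has -1 in the third entry of its r-vector, so it moves the
    normalised coordinate by 2 c3, which this multiplier compensates. For \<open>S1\<close> and
    \<open>S2\<close> that entry is 0.\<close>
  show "(\<lambda>u. - 2 * c3 u) \<in> A" by (intro mem_A)
  fix u assume u: "u \<in> U"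
  show "\<forall>k<8. dir S3 (\<lambda>u. zcoord k (w u)) u =
      zcoord k (zorn_scale (- 2 * c3 u) (w u) - zder 0 (vector [0, 0, - 1]) 0 (w u))"
    unfolding all_less_8 zcoord_w
    by (simp only: dir_simps mem_A mnN_A u dir_S3_values)
      (simp add: zcoord_def w_def zorn_component_simps algebra_simps power2_eq_square)
qed

end

theorem theorem6p1:
  fixes P IP \<eta> chi :: "real \<Rightarrow> 'a::{real_normed_field,banach}"
    and I :: "real set" and U :: "(real^5) set"
  assumes "open I" and "is_interval I"
    and "generalised_chazy (2/3) I P"
    and "\<forall>x\<in>I. (IP has_vector_derivative P x) (at x)"
    and "chazy_fields.eta_equation P \<eta> I"
    and "\<exists>x\<in>I. \<eta> x \<noteq> 0"
    and "\<forall>x\<in>I. \<eta> x \<noteq> 0 \<longrightarrow> (chi has_vector_derivative 1 / (\<eta> x)^2) (at x)"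
    and "open U" and "U \<noteq> {}"
    and "\<forall>u\<in>U. u$1 \<in> I \<and> \<eta> (u$1) \<noteq> 0"
  shows "pairwise_bracket_generates_split_g2 U
    (restrict_field U (chazy_fields.S1 P IP \<eta>))
    (restrict_field U (chazy_fields.S2 IP \<eta>))
    (restrict_field U (chazy_fields.S3 P IP \<eta> chi))"
proof -
  interpret chazy_setting P IP \<eta> chi I U
    using assms by unfold_locales auto
  obtain u where u: "u \<in> U" using \<open>U \<noteq> {}\<close> by blast
  \<comment> \<open>The q-component of \<open>S2\<close> is an exponential over 4
    \<open>\<eta>\<close>, hence nonzero at any point of \<open>U\<close>; this rules out a
    kernel.\<close>
  hence "restrict_field U S2 u $ 5 \<noteq> 0"
    using assms(10) by (simp add: restrict_field_def S2_def X1_def)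
  hence "restrict_field U S2 \<noteq> 0" by auto
  thus ?thesis by (rule generates[OF lifts_S1 lifts_S2 lifts_S3])
qed

end
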